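(* Let $p=p(n)\in[0,1]$ satisfy $\frac{\log n+\omega(1)}{n}\le p\le \frac{1.1\log n}{n}$, i.e. $np-\log n\to\infty$ as $n\to\infty$ and $p\le 1.1\log n/n$. Let $G\sim G(n,p)$. Then $$\lim_{n\to\infty}\Pr\big(\sigma(G)=\delta(G)\big)=1.$$
   Context: $G(n,p)$ is the Erdős–Rényi random graph on $n$ vertices in which each of the $\binom n2$ possible edges is present independently with probability $p$. For a graph $G$, the spanning tree packing number $\sigma(G)$ is the maximum number of pairwise edge-disjoint spanning trees contained in $G$, and $\delta(G)$ is the minimum degree of $G$. $\log$ denotes the natural logarithm. *)

theory Defs
  imports Complex_Main
begin

text \<open>Simple graphs on the vertex set {0..<n}; an edge is a 2-element set of vertices.\<close>

definition all_edges :: "nat \<Rightarrow> nat set set" where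
  "all_edges n = {e. \<exists>i j. i < n \<and> j < n \<and> i \<noteq> j \<and> e = {i, j}}"

text \<open>Probability that G(n,p) (edge set E, each possible edge present independently
  with probability p) satisfies property P.\<close>
definition gnp_prob :: "nat \<Rightarrow> real \<Rightarrow> (nat set set \<Rightarrow> bool) \<Rightarrow> real" where
  "gnp_prob n p P = (\<Sum>E\<in>Pow (all_edges n).
      (if P E then p ^ card E * (1 - p) ^ (card (all_edges n) - card E) else 0))"

definition edge_rel :: "nat set set \<Rightarrow> (nat \<times> nat) set" where
  "edge_rel T = {(a, b). {a, b} \<in> T}"

definition connected_on :: "nat \<Rightarrow> nat set set \<Rightarrow> bool" where
  "connected_on n T \<longleftrightarrow> (\<forall>u<n. \<forall>v<n. (u, v) \<in> (edge_rel T)\<^sup>*)"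

definition has_cycle :: "nat set set \<Rightarrow> bool" where
  "has_cycle T \<longleftrightarrow> (\<exists>vs. length vs \<ge> 3 \<and> distinct vs \<and>
      (\<forall>i < length vs - 1. {vs ! i, vs ! (i + 1)} \<in> T) \<and> {last vs, hd vs} \<in> T)"

text \<open>T is (the edge set of) a spanning tree of the graph ({0..<n}, E).\<close>
definition spanning_tree :: "nat \<Rightarrow> nat set set \<Rightarrow> nat set set \<Rightarrow> bool" where
  "spanning_tree n E T \<longleftrightarrow> T \<subseteq> E \<and> connected_on n T \<and> \<not> has_cycle T"

text \<open>Spanning tree packing number: maximum number of pairwise edge-disjoint spanning trees.\<close>
definition sigma :: "nat \<Rightarrow> nat set set \<Rightarrow> nat" where
  "sigma n E = (GREATEST k. \<exists>Ts :: nat \<Rightarrow> nat set set.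
      (\<forall>i<k. spanning_tree n E (Ts i)) \<and>
      (\<forall>i<k. \<forall>j<k. i \<noteq> j \<longrightarrow> Ts i \<inter> Ts j = {}))"

definition degree :: "nat \<Rightarrow> nat set set \<Rightarrow> nat \<Rightarrow> nat" where
  "degree n E v = card {u. u < n \<and> u \<noteq> v \<and> {u, v} \<in> E}"

definition min_degree :: "nat \<Rightarrow> nat set set \<Rightarrow> nat" where
  "min_degree n E = Min (degree n E ` {0..<n})"

end

theory Submission
  imports Defs "HOL-Real_Asymp.Real_Asymp"
begin

text \<open>Let k be the minimum degree, L = ln n, and call a vertex small if its degree is below L/8. As
  n p \<le> 1.1 L, with high probability some vertex has degree at most L/20, so k \<le> L/20. First
  moment bounds show that with high probability no two small vertices are at distance at most two,
  sets of linear (but small) size span few edges, and any two disjoint sets of linear size are joined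
  by at least L/10 edges. Hence the graph without its small vertices is 2k-edge-connected and so, by
  the theorem of Tutte and Nash-Williams, contains k edge-disjoint spanning trees. Every small vertex
  has at least k neighbours, none of which is small, and can be attached to these trees as a leaf.\<close>

section \<open>Edge-disjoint connected spanning subgraphs\<close>

text \<open>The small vertices must be split off because a vertex of degree k is itself a cut of
  only k edges, while the packing theorem asks for 2k. Three margins fix the constants. (1) In a set
  of at most \<beta> n vertices without small ones, each vertex has degree at least L/8, loses at
  most one edge to the small vertices and on average at most 2L/100 to the set itself; the remaining
  L/8 - L/50 - 1 cross the cut and have to reach 2 (L/20) = L/10. (2) Two given vertices are both
  small with probability at most e^6 n^(-1.2), and there are about n^2 p + n^3 p^2 = n (ln n)^O(1)
  expected ways for them to be at distance at most two. (3) A given vertex has degree near L/20 with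
  probability at least about n^(-59/60): the density costs an exponent 1.1, and the number of ways
  to choose the neighbours returns 7/60. An exponent below 1 makes such a vertex likely to exist.
  Degrees are dependent; instead of a second moment, (3) looks only at the first n/L^2 vertices,
  whose edges to all other vertices are independent.\<close>

abbreviation conn :: "nat set set \<Rightarrow> (nat \<times> nat) set" where
  "conn A \<equiv> (edge_rel A)\<^sup>*"

section \<open>Connectivity and forests\<close>

lemma edge_rel_iff [simp]: "(a, b) \<in> edge_rel A \<longleftrightarrow> {a, b} \<in> A"
  by (simp add: edge_rel_def)

lemma edge_rel_mono: "A \<subseteq> B \<Longrightarrow> edge_rel A \<subseteq> edge_rel B"
  by (auto simp: edge_rel_def)

lemma conn_mono: "A \<subseteq> B \<Longrightarrow> (x, y) \<in> conn A \<Longrightarrow> (x, y) \<in> conn B"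
  using rtrancl_mono[OF edge_rel_mono] by blast

lemma conn_edge: "{u, v} \<in> A \<Longrightarrow> (u, v) \<in> conn A"
  by (simp add: r_into_rtrancl)

lemma conn_sym: "(x, y) \<in> conn A \<Longrightarrow> (y, x) \<in> conn A"
proof -
  have "sym (edge_rel A)"
    by (auto simp: sym_def insert_commute)
  then show "(x, y) \<in> conn A \<Longrightarrow> (y, x) \<in> conn A"
    using sym_rtrancl by (metis symD)
qed

lemma conn_trans: "(x, y) \<in> conn A \<Longrightarrow> (y, z) \<in> conn A \<Longrightarrow> (x, z) \<in> conn A"
  by (rule rtrancl_trans)

lemma conn_subset_conn:
  assumes "\<And>a b. {a, b} \<in> A \<Longrightarrow> (a, b) \<in> conn B" and "(x, y) \<in> conn A"
  shows "(x, y) \<in> conn B"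
  using assms(2)
proof (induction rule: rtrancl_induct)
  case (step y z)
  then have "(y, z) \<in> conn B" using assms(1) by simp
  then show ?case using step.IH conn_trans by blast
qed simp

text \<open>A walk can be shortened until it crosses the new edge at most once, in one of its two
  directions.\<close>

lemma conn_insertE:
  assumes "(x, y) \<in> conn (insert {u, v} A)"
  shows "(x, y) \<in> conn A \<or> (x, u) \<in> conn A \<and> (v, y) \<in> conn A \<or>
    (x, v) \<in> conn A \<and> (u, y) \<in> conn A"
  using assms
proof (induction rule: rtrancl_induct)
  case (step y z)
  have "{y, z} = {u, v} \<or> {y, z} \<in> A"
    using step.hyps(2) by simp
  then consider "y = u" "z = v" | "y = v" "z = u" | "(y, z) \<in> conn A"
    using conn_edge by (auto simp: doubleton_eq_iff)
  then show ?case
  proof cases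
    case 1
    then show ?thesis using step.IH conn_sym conn_trans by (metis rtrancl.rtrancl_refl)
  next
    case 2
    then show ?thesis using step.IH conn_sym conn_trans by (metis rtrancl.rtrancl_refl)
  next
    case 3
    then show ?thesis using step.IH conn_trans by blast
  qed
qed simp

lemma conn_insert_absorb:
  assumes "(u, v) \<in> conn A" "(x, y) \<in> conn (insert {u, v} A)"
  shows "(x, y) \<in> conn A"
  using conn_insertE[OF assms(2)] assms(1) conn_sym conn_trans by metis

text \<open>Acyclicity in terms of bridges: no edge can be bypassed. This turns exchange arguments
  into statements about \<open>conn\<close>, with no cycles as vertex lists; loops are excluded
  because \<open>conn\<close> is reflexive.\<close>

definition forest :: "nat set set \<Rightarrow> bool" where
  "forest A \<longleftrightarrow> (\<forall>u v. {u, v} \<in> A \<longrightarrow> (u, v) \<notin> conn (A - {{u, v}}))"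

lemma forest_empty: "forest {}"
  by (simp add: forest_def)

lemma forest_subset: "forest A \<Longrightarrow> B \<subseteq> A \<Longrightarrow> forest B"
  unfolding forest_def by (meson Diff_mono conn_mono order_refl subsetD)

text \<open>If an old edge ab could now be bypassed, the bypass would run through uv; its two pieces
  together with ab would then join u to v already in \<open>A\<close>.\<close>

lemma forest_insert:
  assumes "forest A" "(u, v) \<notin> conn A"
  shows "forest (insert {u, v} A)"
  unfolding forest_def
proof (intro allI impI notI)
  fix a b
  assume ab: "{a, b} \<in> insert {u, v} A"
    and c: "(a, b) \<in> conn (insert {u, v} A - {{a, b}})"
  have nA: "{u, v} \<notin> A" using assms(2) conn_edge by blast
  show False
  proof (cases "{a, b} = {u, v}")
    case True
    then have "(a, b) \<in> conn A" using c nA by simp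
    then show False using True assms(2) conn_sym by (auto simp: doubleton_eq_iff)
  next
    case False
    then have "{a, b} \<in> A" using ab by simp
    then have abA: "(a, b) \<in> conn A" and n: "(a, b) \<notin> conn (A - {{a, b}})"
      using assms(1) conn_edge by (auto simp: forest_def)
    have "(a, b) \<in> conn (insert {u, v} (A - {{a, b}}))"
      using c False by (simp add: insert_Diff_if)
    from conn_insertE[OF this] n
    have "(a, u) \<in> conn (A - {{a, b}}) \<and> (v, b) \<in> conn (A - {{a, b}}) \<or>
      (a, v) \<in> conn (A - {{a, b}}) \<and> (u, b) \<in> conn (A - {{a, b}})" by blast
    then have "(a, u) \<in> conn A \<and> (v, b) \<in> conn A \<or> (a, v) \<in> conn A \<and> (u, b) \<in> conn A"
      using conn_mono[of "A - {{a, b}}" A] by blast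
    then show False using abA assms(2) conn_sym conn_trans by metis
  qed
qed

text \<open>A smallest set of edges connecting u to v is a path between them, obtained here without
  a notion of path.\<close>

lemma minimal_connecting_subset:
  assumes "finite A" "(u, v) \<in> conn A"
  obtains P where "P \<subseteq> A" "(u, v) \<in> conn P" "\<And>f. f \<in> P \<Longrightarrow> (u, v) \<notin> conn (P - {f})"
proof -
  obtain P where P: "P \<subseteq> A \<and> (u, v) \<in> conn P"
    and m: "\<And>Q. Q \<subseteq> A \<and> (u, v) \<in> conn Q \<Longrightarrow> card P \<le> card Q"
    using ex_has_least_nat[of "\<lambda>P. P \<subseteq> A \<and> (u, v) \<in> conn P" A card] assms(2) by blast
  have "(u, v) \<notin> conn (P - {f})" if "f \<in> P" for f
  proof
    assume "(u, v) \<in> conn (P - {f})"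
    then have "card P \<le> card (P - {f})" using P m by blast
    moreover have "finite P" using P assms(1) finite_subset by blast
    ultimately show False using that by (metis card_Diff1_less not_less)
  qed
  then show ?thesis using that P by blast
qed

text \<open>A forest contains at most one path between two vertices, so removing any edge of that path
  disconnects them.\<close>
lemma forest_exchange:
  assumes "finite A" "forest A" "(u, v) \<in> conn A"
  shows "\<exists>P\<subseteq>A. (u, v) \<in> conn P \<and> (\<forall>a b. {a, b} \<in> P \<longrightarrow> forest (insert {u, v} (A - {{a, b}})))"
proof -
  obtain P where P: "P \<subseteq> A" "(u, v) \<in> conn P" "\<And>f. f \<in> P \<Longrightarrow> (u, v) \<notin> conn (P - {f})"
    using minimal_connecting_subset[OF assms(1,3)] by blast
  have "forest (insert {u, v} (A - {f}))" if f: "f \<in> P" "f = {a, b}" for f a b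
  proof (rule forest_insert)
    show "forest (A - {f})" using assms(2) forest_subset by blast
    show "(u, v) \<notin> conn (A - {f})"
    proof
      assume uv: "(u, v) \<in> conn (A - {f})"
      have "(u, v) \<in> conn (insert {a, b} (P - {f}))"
        using P(2) f by (simp add: insert_absorb)
      from conn_insertE[OF this] P(3)[OF f(1)]
      have "(u, a) \<in> conn (P - {f}) \<and> (b, v) \<in> conn (P - {f}) \<or>
        (u, b) \<in> conn (P - {f}) \<and> (a, v) \<in> conn (P - {f})" by blast
      then have "(u, a) \<in> conn (A - {f}) \<and> (b, v) \<in> conn (A - {f}) \<or>
        (u, b) \<in> conn (A - {f}) \<and> (a, v) \<in> conn (A - {f})"
        using conn_mono[of "P - {f}" "A - {f}"] P(1) by blast
      \<comment> \<open>The two pieces of P - {f}, closed up by the connection between u and v,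
        bypass f.\<close>
      then have "(a, b) \<in> conn (A - {f})"
        using uv conn_sym conn_trans by metis
      then show False using assms(2) P(1) f by (auto simp: forest_def)
    qed
  qed
  then show ?thesis using P(1,2) by (intro exI[of _ P]) simp
qed

section \<open>Counting components\<close>

definition classes :: "nat set \<Rightarrow> nat set set \<Rightarrow> nat set set" where
  "classes V A = (\<lambda>v. conn A `` {v}) ` V"

lemma class_eq_iff: "conn A `` {u} = conn A `` {v} \<longleftrightarrow> (u, v) \<in> conn A"
  using conn_sym conn_trans by blast

lemma card_classes_pos: "finite V \<Longrightarrow> v \<in> V \<Longrightarrow> card (classes V A) \<ge> 1"
  unfolding classes_def by (auto simp: Suc_le_eq card_gt_0_iff)

text \<open>Closing up under the larger relation maps the old classes onto the new ones and sends
  the classes of \<open>u\<close> and \<open>v\<close> to the same one, so the map is not injective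
  and the image is smaller.\<close>

lemma card_classes_insert:
  assumes "finite V" "u \<in> V" "v \<in> V" "(u, v) \<notin> conn A"
  shows "card (classes V (insert {u, v} A)) < card (classes V A)"
proof -
  let ?B = "insert {u, v} A"
  let ?g = "\<lambda>C. conn ?B `` C"
  have g: "?g (conn A `` {x}) = conn ?B `` {x}" for x
    using conn_mono[of A ?B] conn_trans by blast
  have im: "?g ` classes V A = classes V ?B"
    by (simp add: classes_def image_image g)
  have fin: "finite (classes V A)" using assms(1) by (simp add: classes_def)
  have "conn A `` {u} \<noteq> conn A `` {v}" using assms(4) class_eq_iff by blast
  moreover have "?g (conn A `` {u}) = ?g (conn A `` {v})"
    unfolding g class_eq_iff by (simp add: conn_edge)
  ultimately have "\<not> inj_on ?g (classes V A)"
    using assms(2,3) by (auto simp: inj_on_def classes_def)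
  then have "card (?g ` classes V A) \<noteq> card (classes V A)"
    using eq_card_imp_inj_on[OF fin] by blast
  then show ?thesis using card_image_le[OF fin, of ?g] im by simp
qed

text \<open>When the edges of \<open>X\<close> are added one at a time, each joins two different
  components and lowers their number. This bounds the edges that a forest keeps after the components
  of \<open>B\<close> are contracted.\<close>

lemma card_classes_forest:
  assumes "finite V" "finite X" "forest (B \<union> X)" "B \<inter> X = {}"
    "\<And>e. e \<in> X \<Longrightarrow> \<exists>u\<in>V. \<exists>v\<in>V. e = {u, v}"
  shows "card (classes V (B \<union> X)) + card X \<le> card (classes V B)"
  using assms(2-)
proof (induction X rule: finite_induct)
  case (insert e X)
  obtain u v where uv: "u \<in> V" "v \<in> V" "e = {u, v}" using insert.prems by blast
  have "B \<union> insert e X - {e} = B \<union> X" using insert by auto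
  then have "(u, v) \<notin> conn (B \<union> X)"
    using insert.prems(1) uv unfolding forest_def by (metis UnCI insertCI)
  from card_classes_insert[OF assms(1) uv(1,2) this]
  have "card (classes V (B \<union> insert e X)) < card (classes V (B \<union> X))" using uv by simp
  moreover have "forest (B \<union> X)" using insert.prems(1) by (rule forest_subset) auto
  then have "card (classes V (B \<union> X)) + card X \<le> card (classes V B)"
    using insert by auto
  ultimately show ?case using insert.hyps by simp
qed simp

lemma conn_closed:
  assumes "(x, y) \<in> conn A" "x \<in> V" "\<Union>A \<subseteq> V"
  shows "y \<in> V"
  using assms by (induction rule: rtrancl_induct) auto

section \<open>Maximal packings of forests and the packing theorem\<close>

definition packing :: "nat \<Rightarrow> nat set set \<Rightarrow> (nat \<Rightarrow> nat set set) \<Rightarrow> bool" where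
  "packing k E F \<longleftrightarrow> (\<forall>i<k. F i \<subseteq> E \<and> forest (F i)) \<and>
    (\<forall>i<k. \<forall>j<k. i \<noteq> j \<longrightarrow> F i \<inter> F j = {})"

definition max_packing :: "nat \<Rightarrow> nat set set \<Rightarrow> (nat \<Rightarrow> nat set set) \<Rightarrow> bool" where
  "max_packing k E F \<longleftrightarrow> packing k E F \<and>
    (\<forall>F'. packing k E F' \<longrightarrow> (\<Sum>i<k. card (F' i)) \<le> (\<Sum>i<k. card (F i)))"

text \<open>An exchange leaves all sizes unchanged, so it leads from a maximal packing to a maximal
  packing, while the uncovered edge \<open>e\<close> and the covered edge \<open>f\<close> trade
  places.\<close>

definition exchange :: "nat \<Rightarrow> nat set set \<Rightarrow> ((nat \<Rightarrow> nat set set) \<times> (nat \<Rightarrow> nat set set)) set" where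
  "exchange k E = {(F, F'). \<exists>i<k. \<exists>e\<in>E - (\<Union>j<k. F j). \<exists>f\<in>F i.
     forest (insert e (F i - {f})) \<and> F' = F(i := insert e (F i - {f}))}"

lemma exchangeE:
  assumes "(F, F') \<in> exchange k E"
  obtains i e f where "i < k" "e \<in> E - (\<Union>j<k. F j)" "f \<in> F i"
    "forest (insert e (F i - {f}))" "F' = F(i := insert e (F i - {f}))"
  using assms unfolding exchange_def by blast

text \<open>Letting \<open>T\<close> be any forest inside \<open>insert e (F i)\<close> covers both
  uses: adding \<open>e\<close>, and exchanging it for another edge.\<close>

lemma packing_update:
  assumes "packing k E F" "i < k" "forest T" "T \<subseteq> insert e (F i)" "e \<in> E - (\<Union>j<k. F j)"
  shows "packing k E (F(i := T))"
proof -
  have F: "F j \<subseteq> E" "forest (F j)" "e \<notin> F j" if "j < k" for j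
    using assms(1,5) that by (auto simp: packing_def)
  have d: "F j \<inter> F l = {}" if "j < k" "l < k" "j \<noteq> l" for j l
    using assms(1) that by (simp add: packing_def)
  have T: "T \<subseteq> E" using assms(4,5) F(1)[OF assms(2)] by blast
  have Tj: "T \<inter> F j = {}" if "j < k" "j \<noteq> i" for j
    using assms(4) F(3)[OF that(1)] d[OF assms(2) that(1)] that(2) by blast
  show ?thesis
    unfolding packing_def using assms(3) F T d Tj by (auto simp: Int_commute)
qed

lemma sum_update:
  fixes F :: "nat \<Rightarrow> nat set set"
  assumes "i < k"
  shows "(\<Sum>j<k. card ((F(i := T)) j)) + card (F i) = (\<Sum>j<k. card (F j)) + card T"
proof -
  have "(\<Sum>j<k. card ((F(i := T)) j)) = card T + (\<Sum>j\<in>{..<k} - {i}. card (F j))"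
    using assms by (subst sum.remove[of _ i]) auto
  moreover have "(\<Sum>j<k. card (F j)) = card (F i) + (\<Sum>j\<in>{..<k} - {i}. card (F j))"
    using assms by (subst sum.remove[of _ i]) auto
  ultimately show ?thesis by simp
qed

lemma exchange_max_packing:
  assumes "finite E" "max_packing k E F" "(F, F') \<in> exchange k E"
  shows "max_packing k E F'"
proof -
  obtain i e f where i: "i < k" and e: "e \<in> E - (\<Union>j<k. F j)" and f: "f \<in> F i"
    and fo: "forest (insert e (F i - {f}))" and F': "F' = F(i := insert e (F i - {f}))"
    by (rule exchangeE[OF assms(3)])
  have p: "packing k E F" using assms(2) by (simp add: max_packing_def)
  have p': "packing k E F'"
    unfolding F' by (rule packing_update[OF p i fo _ e]) auto
  have "F i \<subseteq> E" using p i by (simp add: packing_def)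
  then have "finite (F i)" using assms(1) by (rule finite_subset)
  moreover have "e \<notin> F i" using e i by blast
  ultimately have "card (insert e (F i - {f})) = card (F i)"
    using f card_Suc_Diff1[of "F i" f] by simp
  then have "(\<Sum>j<k. card (F' j)) = (\<Sum>j<k. card (F j))"
    using sum_update[OF i, of F "insert e (F i - {f})"] F' by simp
  then show ?thesis using assms(2) p' by (simp add: max_packing_def)
qed

lemma max_packing_exists:
  assumes "finite E"
  obtains F where "max_packing k E F"
proof -
  have p: "packing k E (\<lambda>_. {})" by (simp add: packing_def forest_empty)
  have b: "(\<Sum>i<k. card (F i)) < Suc (k * card E)" if "packing k E F" for F
  proof -
    have "(\<Sum>i<k. card (F i)) \<le> (\<Sum>i<k. card E)"
      using that assms by (intro sum_mono card_mono) (auto simp: packing_def)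
    then show ?thesis by simp
  qed
  from ex_has_greatest_nat[of "packing k E" _ "\<lambda>F. \<Sum>i<k. card (F i)", OF p] b
  show ?thesis using that unfolding max_packing_def by (metis less_imp_le)
qed

text \<open>The only classes that an edge can leave are those of its two ends. This is the factor 2
  in the cut condition of the packing theorem.\<close>

lemma card_crossing_le_2:
  "card {C \<in> classes V A. {a, b} \<inter> C \<noteq> {} \<and> {a, b} - C \<noteq> {}} \<le> 2"
proof -
  have "{C \<in> classes V A. {a, b} \<inter> C \<noteq> {} \<and> {a, b} - C \<noteq> {}} \<subseteq> {conn A `` {a}, conn A `` {b}}"
    unfolding classes_def using class_eq_iff by auto
  from card_mono[OF _ this] show ?thesis
    by (auto simp: card_insert_if split: if_splits)
qed

text \<open>The edge set R below consists of the edges left out by some maximal packing of forests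
  reachable from a fixed one F by exchanges. Each forest of F spans R, and every edge outside R is
  used by F, so contracting the t components of R leaves at most k (t - 1) edges, too few for
  t > 1 cuts of 2k edges each.\<close>
theorem tree_packing:
  assumes fV: "finite V" and fE: "finite E"
    and EV: "\<And>e. e \<in> E \<Longrightarrow> \<exists>u\<in>V. \<exists>v\<in>V. e = {u, v}"
    and cut: "\<And>C. C \<subseteq> V \<Longrightarrow> C \<noteq> {} \<Longrightarrow> C \<noteq> V \<Longrightarrow>
      2 * k \<le> card {e \<in> E. e \<inter> C \<noteq> {} \<and> e - C \<noteq> {}}"
  shows "\<exists>F. (\<forall>i<k. F i \<subseteq> E) \<and> (\<forall>i<k. \<forall>j<k. i \<noteq> j \<longrightarrow> F i \<inter> F j = {}) \<and>
    (\<forall>i<k. \<forall>u\<in>V. \<forall>v\<in>V. (u, v) \<in> conn (F i))"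
proof -
  obtain F where F: "max_packing k E F" using max_packing_exists[OF fE] by blast
  define R where "R = (\<Union>F'\<in>{F'. (F, F') \<in> (exchange k E)\<^sup>*}. E - (\<Union>j<k. F' j))"
  have max: "max_packing k E F'" if "(F, F') \<in> (exchange k E)\<^sup>*" for F'
    using that F by (induction rule: rtrancl_induct) (auto intro: exchange_max_packing[OF fE])
  \<comment> \<open>By maximality an uncovered edge cannot be added to any forest, so each forest
    has a path between its ends. Every edge of this path can be exchanged against the uncovered one,
    becomes uncovered itself, and therefore lies in \<open>R\<close>.\<close>
  have key: "(u, v) \<in> conn (F' i \<inter> R)"
    if F': "(F, F') \<in> (exchange k E)\<^sup>*" and e: "{u, v} \<in> E - (\<Union>j<k. F' j)" and i: "i < k"
    for F' u v i
  proof -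
    have m: "max_packing k E F'" using max F' by blast
    then have p: "packing k E F'" by (simp add: max_packing_def)
    have fo: "forest (F' i)" and sub: "F' i \<subseteq> E"
      using p i by (simp_all add: packing_def)
    have fin: "finite (F' i)" using sub fE by (rule finite_subset)
    have en: "{u, v} \<notin> F' i" using e i by blast
    have uv: "(u, v) \<in> conn (F' i)"
    proof (rule ccontr)
      assume n: "(u, v) \<notin> conn (F' i)"
      let ?T = "insert {u, v} (F' i)"
      have "packing k E (F'(i := ?T))"
        by (rule packing_update[OF p i forest_insert[OF fo n] _ e]) auto
      then have "(\<Sum>j<k. card ((F'(i := ?T)) j)) \<le> (\<Sum>j<k. card (F' j))"
        using m unfolding max_packing_def by blast
      with sum_update[OF i, of F' ?T] show False using fin en by simp
    qed
    obtain P where P: "P \<subseteq> F' i" "(u, v) \<in> conn P"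
      "\<forall>a b. {a, b} \<in> P \<longrightarrow> forest (insert {u, v} (F' i - {{a, b}}))"
      using forest_exchange[OF fin fo uv] by (elim exE conjE)
    have "P \<subseteq> R"
    proof
      fix f assume f: "f \<in> P"
      have fE': "f \<in> E" using f P(1) sub by blast
      let ?G = "F'(i := insert {u, v} (F' i - {f}))"
      have "(F', ?G) \<in> exchange k E"
      proof -
        obtain a b where ab: "f = {a, b}" using EV[OF fE'] by blast
        have "f \<in> F' i" using f P(1) by blast
        moreover have "forest (insert {u, v} (F' i - {f}))" using P(3) f ab by simp
        ultimately show ?thesis unfolding exchange_def using i e by blast
      qed
      then have r: "(F, ?G) \<in> (exchange k E)\<^sup>*" using F' by (meson rtrancl.rtrancl_into_rtrancl)
      have "f \<noteq> {u, v}" using f P(1) en by blast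
      moreover have "f \<notin> F' j" if "j < k" "j \<noteq> i" for j
      proof -
        have "F' i \<inter> F' j = {}" using p that i by (simp add: packing_def)
        then show ?thesis using f P(1) by blast
      qed
      ultimately have "f \<notin> (\<Union>j<k. ?G j)" by auto
      then show "f \<in> R" unfolding R_def using r fE' by blast
    qed
    then show ?thesis using conn_mono[of P "F' i \<inter> R"] P by blast
  qed
  \<comment> \<open>Carries connectivity inside \<open>R\<close> back along the exchanges to
    \<open>F\<close>. Undoing one exchange removes the edge \<open>e\<close>, but \<open>key\<close>
    for the earlier packing joins the ends of \<open>e\<close> inside \<open>R\<close>.\<close>
  have pull: "(x, y) \<in> conn (F i \<inter> R)"
    if F': "(F, F') \<in> (exchange k E)\<^sup>*" and "(x, y) \<in> conn (F' i \<inter> R)" "i < k" for F' x y i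
    using that
  proof (induction arbitrary: x y rule: rtrancl_induct)
    case (step F1 F2)
    obtain l e f where "l < k" and e: "e \<in> E - (\<Union>j<k. F1 j)" and "f \<in> F1 l"
      and "forest (insert e (F1 l - {f}))" and F2: "F2 = F1(l := insert e (F1 l - {f}))"
      by (rule exchangeE[OF step.hyps(2)])
    have "(x, y) \<in> conn (F1 i \<inter> R)"
    proof (cases "i = l")
      case True
      have "e \<in> E" using e by simp
      then obtain u v where uv: "e = {u, v}" using EV[of e] by blast
      have "(u, v) \<in> conn (F1 i \<inter> R)"
        using key[OF step.hyps(1) _ step.prems(2)] e uv by simp
      moreover have "(x, y) \<in> conn (insert {u, v} (F1 i \<inter> R))"
        by (rule conn_mono[OF _ step.prems(1)]) (use True F2 uv in auto)
      ultimately show ?thesis by (rule conn_insert_absorb)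
    next
      case False
      then show ?thesis using step.prems F2 by simp
    qed
    then show ?case using step by blast
  qed simp
  have RE: "R \<subseteq> E" unfolding R_def by blast
  have span: "(x, y) \<in> conn (F i \<inter> R)" if "(x, y) \<in> conn R" "i < k" for x y i
  proof (rule conn_subset_conn[OF _ that(1)])
    fix a b assume "{a, b} \<in> R"
    then obtain F' where F': "(F, F') \<in> (exchange k E)\<^sup>*" and ab: "{a, b} \<in> E - (\<Union>j<k. F' j)"
      unfolding R_def by blast
    show "(a, b) \<in> conn (F i \<inter> R)" by (rule pull[OF F' key[OF F' ab that(2)] that(2)])
  qed
  have cl: "classes V (F i \<inter> R) = classes V R" if "i < k" for i
  proof -
    have "(x, y) \<in> conn (F i \<inter> R) \<longleftrightarrow> (x, y) \<in> conn R" for x y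
      using span[OF _ that, of x y] conn_mono[of "F i \<inter> R" R x y] by blast
    then show ?thesis by (simp add: classes_def Image_singleton)
  qed
  \<comment> \<open>The empty sequence of exchanges already puts every edge missed by
    \<open>F\<close> into \<open>R\<close>.\<close>
  have out: "E - R \<subseteq> (\<Union>i<k. F i - R)"
    unfolding R_def by blast
  have pF: "packing k E F" using F by (simp add: max_packing_def)
  have whole: "conn R `` {v} = V" if v: "v \<in> V" and k: "k > 0" for v
  proof (rule ccontr)
    assume nV: "conn R `` {v} \<noteq> V"
    let ?t = "card (classes V R)"
    have sub: "C \<subseteq> V" "C \<noteq> {}" if "C \<in> classes V R" for C
      using that conn_closed[of _ _ R V] RE EV unfolding classes_def by blast+
    have ne: "C \<noteq> V" if C: "C \<in> classes V R" for C
    proof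
      assume CV: "C = V"
      obtain w where w: "C = conn R `` {w}" using C unfolding classes_def by blast
      then have "(w, v) \<in> conn R" using CV v by blast
      then have "conn R `` {w} = conn R `` {v}" using class_eq_iff by blast
      then show False using nV w CV by simp
    qed
    let ?cr = "\<lambda>e C. e \<inter> C \<noteq> {} \<and> e - C \<noteq> {}"
    have fC: "finite (classes V R)" using fV by (simp add: classes_def)
    have t: "?t \<ge> 1"
      using card_classes_pos[OF fV v] .
    have crR: "e \<notin> R" if C: "C \<in> classes V R" and eE: "e \<in> E" and cr: "?cr e C" for e C
    proof
      assume "e \<in> R"
      obtain a b where ab: "e = {a, b}" using EV[OF eE] by blast
      then have "(a, b) \<in> conn R" using \<open>e \<in> R\<close> conn_edge by blast
      then have "a \<in> C \<longleftrightarrow> b \<in> C"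
        using C conn_sym[of a b R] conn_trans[of _ _ R] unfolding classes_def by blast
      then show False using cr ab by blast
    qed
    \<comment> \<open>Double counting of pairs of a class and an edge leaving it. Edges of
      \<open>R\<close> stay inside a class, so only E - R contributes.\<close>
    have "?t * (2 * k) = (\<Sum>C\<in>classes V R. 2 * k)" by simp
    also have "\<dots> \<le> (\<Sum>C\<in>classes V R. card {e \<in> E. ?cr e C})"
      by (rule sum_mono) (rule cut[OF sub ne])
    also have "\<dots> = (\<Sum>C\<in>classes V R. card {e \<in> E - R. ?cr e C})"
    proof (rule sum.cong[OF refl])
      fix C assume "C \<in> classes V R"
      then have "{e \<in> E. ?cr e C} = {e \<in> E - R. ?cr e C}" using crR[of C] by blast
      then show "card {e \<in> E. ?cr e C} = card {e \<in> E - R. ?cr e C}" by (rule arg_cong)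
    qed
    also have "\<dots> = (\<Sum>e\<in>E - R. card {C \<in> classes V R. ?cr e C})"
      using fE fC by (intro sum_multicount_gen) auto
    also have "\<dots> \<le> (\<Sum>e\<in>E - R. 2)"
    proof (rule sum_mono)
      fix e assume "e \<in> E - R"
      then obtain a b where "e = {a, b}" using EV[of e] by blast
      then show "card {C \<in> classes V R. ?cr e C} \<le> 2" using card_crossing_le_2[of V R a b] by simp
    qed
    also have "\<dots> = 2 * card (E - R)" by simp
    finally have lower: "?t * k \<le> card (E - R)" by simp
    \<comment> \<open>The components of F i \<inter> R are those of \<open>R\<close>; after
      contracting them, F i - R is a forest on \<open>?t\<close> vertices.\<close>
    have each: "card (F i - R) + 1 \<le> ?t" if i: "i < k" for i
    proof -
      have FE: "F i \<subseteq> E" and "forest (F i)" using pF i by (simp_all add: packing_def)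
      have un: "(F i \<inter> R) \<union> (F i - R) = F i" by blast
      have "card (classes V ((F i \<inter> R) \<union> (F i - R))) + card (F i - R) \<le> card (classes V (F i \<inter> R))"
      proof (rule card_classes_forest[OF fV])
        show "finite (F i - R)" using finite_subset[OF FE fE] by simp
        show "forest ((F i \<inter> R) \<union> (F i - R))" using \<open>forest (F i)\<close> un by simp
        show "(F i \<inter> R) \<inter> (F i - R) = {}" by blast
        show "\<exists>u\<in>V. \<exists>v\<in>V. e = {u, v}" if "e \<in> F i - R" for e
          using that FE by (intro EV) blast
      qed
      moreover have "card (classes V ((F i \<inter> R) \<union> (F i - R))) \<ge> 1"
        by (rule card_classes_pos[OF fV v])
      ultimately show ?thesis using cl[OF i] by simp
    qed
    have "card (E - R) \<le> card (\<Union>i<k. F i - R)"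
    proof (rule card_mono[OF _ out])
      have "finite (F i)" if "i < k" for i
        using pF fE that finite_subset[of "F i" E] by (simp add: packing_def)
      then show "finite (\<Union>i<k. F i - R)" by simp
    qed
    also have "\<dots> \<le> (\<Sum>i<k. card (F i - R))" by (rule card_UN_le) simp
    also have "\<dots> \<le> (\<Sum>i<k. ?t - 1)" using each by (intro sum_mono) fastforce
    also have "\<dots> = k * (?t - 1)" by simp
    finally have le: "?t * k \<le> k * (?t - 1)" using lower by linarith
    have "k * (?t - 1) < ?t * k" using t k by (cases ?t) auto
    then show False using le by simp
  qed
  have "(u, v) \<in> conn (F i)" if "i < k" "u \<in> V" "v \<in> V" for i u v
    using span[of u v i] whole[of u] that conn_mono[of "F i \<inter> R" "F i"] by auto
  then show ?thesis using pF unfolding packing_def by (intro exI[of _ F]) simp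
qed

section \<open>Spanning trees and minimum degree\<close>

lemma edge_in_all_edges: "e \<in> all_edges n \<Longrightarrow> \<exists>u<n. \<exists>v<n. u \<noteq> v \<and> e = {u, v}"
  by (auto simp: all_edges_def)

lemma finite_all_edges: "finite (all_edges n)"
proof -
  have "all_edges n \<subseteq> Pow {..<n}" by (auto simp: all_edges_def)
  then show ?thesis by (rule finite_subset) simp
qed

lemma all_edgesD: "{u, v} \<in> all_edges n \<Longrightarrow> u < n \<and> v < n \<and> u \<noteq> v"
  by (auto simp: all_edges_def doubleton_eq_iff)

lemma all_edgesI: "u < n \<Longrightarrow> v < n \<Longrightarrow> u \<noteq> v \<Longrightarrow> {u, v} \<in> all_edges n"
  unfolding all_edges_def by blast

definition nbrs :: "nat set set \<Rightarrow> nat \<Rightarrow> nat set" where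
  "nbrs E v = {u. {u, v} \<in> E}"

lemma degree_eq: "E \<subseteq> all_edges n \<Longrightarrow> degree n E v = card (nbrs E v)"
  unfolding degree_def nbrs_def by (intro arg_cong[where f = card]) (use all_edgesD in blast)

lemma finite_nbrs: "E \<subseteq> all_edges n \<Longrightarrow> finite (nbrs E v)"
proof -
  assume "E \<subseteq> all_edges n"
  then have "nbrs E v \<subseteq> {..<n}" unfolding nbrs_def using all_edgesD by blast
  then show ?thesis by (rule finite_subset) simp
qed

text \<open>Each tree has an edge at \<open>v\<close>, and disjoint trees have different ones. The
  bound \<open>n \<ge> 2\<close> matters: on one vertex the empty set is a spanning tree, disjoint
  from itself, and can be repeated without limit.\<close>

lemma disjoint_spanning_trees_le_degree:
  assumes "n \<ge> 2" "v < n" and E: "E \<subseteq> all_edges n"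
    and T: "\<And>i. i < k \<Longrightarrow> spanning_tree n E (Ts i)"
    and disj: "\<And>i j. i < k \<Longrightarrow> j < k \<Longrightarrow> i \<noteq> j \<Longrightarrow> Ts i \<inter> Ts j = {}"
  shows "k \<le> degree n E v"
proof -
  define w where "w = (if v = 0 then 1 else 0 :: nat)"
  have w: "w < n" "w \<noteq> v" using assms(1) by (auto simp: w_def)
  have ex: "\<exists>u. {u, v} \<in> Ts i" if "i < k" for i
  proof -
    have "(v, w) \<in> conn (Ts i)"
      using T[OF that] assms(2) w by (simp add: spanning_tree_def connected_on_def)
    then obtain u where "(v, u) \<in> edge_rel (Ts i)"
      using w(2) by (auto elim: converse_rtranclE)
    then show ?thesis by (auto simp: insert_commute)
  qed
  then obtain g where g: "\<And>i. i < k \<Longrightarrow> {g i, v} \<in> Ts i" by metis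
  have "inj_on g {..<k}"
  proof (rule inj_onI)
    fix i j assume ij: "i \<in> {..<k}" "j \<in> {..<k}" and eq: "g i = g j"
    then have "{g i, v} \<in> Ts i \<inter> Ts j" using g[of i] g[of j] by simp
    then show "i = j" using disj[of i j] ij by auto
  qed
  moreover have "g ` {..<k} \<subseteq> nbrs E v"
    using g T by (auto simp: nbrs_def spanning_tree_def)
  ultimately have "card {..<k} \<le> card (nbrs E v)"
    using card_inj_on_le finite_nbrs[OF E] by blast
  then show ?thesis using degree_eq[OF E] by simp
qed

lemma path_conn:
  assumes "\<And>i. i < m \<Longrightarrow> {vs ! i, vs ! (i + 1)} \<in> T"
  shows "(vs ! 0, vs ! m) \<in> conn T"
  using assms
proof (induction m)
  case (Suc m)
  have "(vs ! 0, vs ! m) \<in> conn T" using Suc by simp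
  moreover have "(vs ! m, vs ! Suc m) \<in> conn T" using Suc.prems[of m] by (simp add: r_into_rtrancl)
  ultimately show ?case by (rule conn_trans)
qed simp

lemma forest_not_has_cycle:
  assumes "forest T"
  shows "\<not> has_cycle T"
proof
  assume "has_cycle T"
  then obtain vs where vs: "length vs \<ge> 3" "distinct vs"
    and p: "\<And>i. i < length vs - 1 \<Longrightarrow> {vs ! i, vs ! (i + 1)} \<in> T"
    and c: "{last vs, hd vs} \<in> T"
    unfolding has_cycle_def by blast
  let ?m = "length vs - 1"
  have ne: "vs \<noteq> []" using vs by auto
  have lh: "last vs = vs ! ?m" "hd vs = vs ! 0" using ne by (simp_all add: last_conv_nth hd_conv_nth)
  have "(vs ! 0, vs ! ?m) \<in> conn (T - {{last vs, hd vs}})"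
  proof (rule path_conn)
    fix i assume i: "i < ?m"
    have "{vs ! i, vs ! (i + 1)} \<noteq> {vs ! ?m, vs ! 0}"
    proof
      assume eq: "{vs ! i, vs ! (i + 1)} = {vs ! ?m, vs ! 0}"
      have "vs ! i \<noteq> vs ! ?m" using i vs by (simp add: nth_eq_iff_index_eq)
      then have "vs ! i = vs ! 0 \<and> vs ! (i + 1) = vs ! ?m" using eq by (auto simp: doubleton_eq_iff)
      moreover have "0 < length vs" "i < length vs" "i + 1 < length vs" "?m < length vs"
        using i vs(1) by linarith+
      \<comment> \<open>An edge of the path can equal the closing edge only if it is the whole path,
        which length at least 3 excludes.\<close>
      ultimately have "i = 0" "i + 1 = ?m" using vs(2) nth_eq_iff_index_eq by metis+
      then show False using vs(1) by simp
    qed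
    then show "{vs ! i, vs ! (i + 1)} \<in> T - {{last vs, hd vs}}" using p[OF i] lh by simp
  qed
  then have "(last vs, hd vs) \<in> conn (T - {{last vs, hd vs}})" using lh conn_sym by simp
  then show False using assms c by (auto simp: forest_def)
qed

text \<open>In a smallest connected spanning subset every edge is a bridge, since an edge that can
  be bypassed could be dropped. Constructions therefore only have to provide connected
  subgraphs.\<close>

lemma connected_contains_spanning_tree:
  assumes E: "E \<subseteq> all_edges n" and C: "C \<subseteq> E" "connected_on n C"
  obtains T where "T \<subseteq> C" "spanning_tree n E T"
proof -
  obtain T where T: "T \<subseteq> C \<and> connected_on n T"
    and m: "\<And>Q. Q \<subseteq> C \<and> connected_on n Q \<Longrightarrow> card T \<le> card Q"
    using ex_has_least_nat[of "\<lambda>P. P \<subseteq> C \<and> connected_on n P" C card] assms(3) by blast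
  have "finite C" using E C finite_all_edges finite_subset by metis
  then have fT: "finite T" using T finite_subset by blast
  have "forest T"
    unfolding forest_def
  proof (intro allI impI notI)
    fix a b assume ab: "{a, b} \<in> T" "(a, b) \<in> conn (T - {{a, b}})"
    have "connected_on n (T - {{a, b}})"
      unfolding connected_on_def
    proof (intro allI impI)
      fix u v assume "u < n" "v < n"
      then have "(u, v) \<in> conn T" using T by (simp add: connected_on_def)
      moreover have "T = insert {a, b} (T - {{a, b}})" using ab(1) by blast
      ultimately show "(u, v) \<in> conn (T - {{a, b}})" using conn_insert_absorb[OF ab(2)] by metis
    qed
    then have "card T \<le> card (T - {{a, b}})" using m T by blast
    then show False using card_Diff1_less[OF fT ab(1)] by simp
  qed
  then show ?thesis
    using that[of T] T C forest_not_has_cycle by (auto simp: spanning_tree_def)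
qed

lemma min_degree_le: "v < n \<Longrightarrow> min_degree n E \<le> degree n E v"
  unfolding min_degree_def by (intro Min_le) auto

lemma min_degree_attained: "n \<ge> 1 \<Longrightarrow> \<exists>v<n. min_degree n E = degree n E v"
  using Min_in[of "degree n E ` {0..<n}"] unfolding min_degree_def by fastforce

text \<open>Only the lower bound is left to be constructed: a vertex of minimum degree supplies the
  upper bound that gives \<open>GREATEST\<close> its value.\<close>

lemma sigma_eq_min_degree:
  assumes n: "n \<ge> 2" and E: "E \<subseteq> all_edges n"
    and C: "\<And>i. i < min_degree n E \<Longrightarrow> C i \<subseteq> E \<and> connected_on n (C i)"
    and disj: "\<And>i j. i < min_degree n E \<Longrightarrow> j < min_degree n E \<Longrightarrow> i \<noteq> j \<Longrightarrow> C i \<inter> C j = {}"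
  shows "sigma n E = min_degree n E"
proof -
  let ?k = "min_degree n E"
  have "\<exists>T\<subseteq>C i. spanning_tree n E T" if "i < ?k" for i
    using C[OF that] connected_contains_spanning_tree[OF E, of "C i"] by metis
  then obtain Ts where Ts: "\<And>i. i < ?k \<Longrightarrow> Ts i \<subseteq> C i \<and> spanning_tree n E (Ts i)" by metis
  have d: "Ts i \<inter> Ts j = {}" if "i < ?k" "j < ?k" "i \<noteq> j" for i j
    using disj[OF that] Ts[OF that(1)] Ts[OF that(2)] by blast
  obtain v where v: "v < n" "?k = degree n E v" using min_degree_attained[of n E] n by auto
  show ?thesis
    unfolding sigma_def
  proof (rule Greatest_equality)
    show "\<exists>Ts. (\<forall>i<?k. spanning_tree n E (Ts i)) \<and> (\<forall>i<?k. \<forall>j<?k. i \<noteq> j \<longrightarrow> Ts i \<inter> Ts j = {})"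
      using Ts d by (intro exI[of _ Ts]) simp
  next
    fix k :: nat assume "\<exists>Ts. (\<forall>i<k. spanning_tree n E (Ts i)) \<and> (\<forall>i<k. \<forall>j<k. i \<noteq> j \<longrightarrow> Ts i \<inter> Ts j = {})"
    then obtain Ts where "\<forall>i<k. spanning_tree n E (Ts i)" "\<forall>i<k. \<forall>j<k. i \<noteq> j \<longrightarrow> Ts i \<inter> Ts j = {}"
      by (elim exE conjE)
    then show "k \<le> ?k"
      using disjoint_spanning_trees_le_degree[OF n v(1) E, of k Ts] v(2) by simp
  qed
qed

text \<open>The vertices of S are attached as leaves, in every tree by a different edge.\<close>
lemma sigma_eq_min_degree_if_cuts:
  assumes n: "n \<ge> 2" and E: "E \<subseteq> all_edges n" and S: "S \<subseteq> {..<n}"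
    and ind: "\<And>u v. u \<in> S \<Longrightarrow> v \<in> S \<Longrightarrow> {u, v} \<notin> E"
    and cut: "\<And>A. A \<subseteq> {..<n} - S \<Longrightarrow> A \<noteq> {} \<Longrightarrow> A \<noteq> {..<n} - S \<Longrightarrow>
      2 * min_degree n E \<le> card {e \<in> E. e \<inter> S = {} \<and> e \<inter> A \<noteq> {} \<and> e - A \<noteq> {}}"
  shows "sigma n E = min_degree n E"
proof -
  let ?k = "min_degree n E"
  let ?V = "{..<n} - S"
  define E' where "E' = {e \<in> E. e \<inter> S = {}}"
  have fE: "finite E" using E finite_all_edges finite_subset by metis
  have fE': "finite E'" using fE by (simp add: E'_def)
  have EV: "\<exists>u\<in>?V. \<exists>v\<in>?V. e = {u, v}" if "e \<in> E'" for e
    using that edge_in_all_edges[of e n] E unfolding E'_def by auto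
  have c: "2 * ?k \<le> card {e \<in> E'. e \<inter> A \<noteq> {} \<and> e - A \<noteq> {}}"
    if "A \<subseteq> ?V" "A \<noteq> {}" "A \<noteq> ?V" for A
    using cut[OF that] by (simp add: E'_def conj_ac)
  have "\<exists>F. (\<forall>i<?k. F i \<subseteq> E') \<and> (\<forall>i<?k. \<forall>j<?k. i \<noteq> j \<longrightarrow> F i \<inter> F j = {}) \<and>
      (\<forall>i<?k. \<forall>u\<in>?V. \<forall>v\<in>?V. (u, v) \<in> conn (F i))"
    using EV c by (intro tree_packing fE') simp_all
  then obtain F where F: "\<forall>i<?k. F i \<subseteq> E'" "\<forall>i<?k. \<forall>j<?k. i \<noteq> j \<longrightarrow> F i \<inter> F j = {}"
    "\<forall>i<?k. \<forall>u\<in>?V. \<forall>v\<in>?V. (u, v) \<in> conn (F i)"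
    by (elim exE conjE)
  have FE: "F i \<subseteq> E'" if "i < ?k" for i using F(1) that by blast
  have Fd: "F i \<inter> F j = {}" if "i < ?k" "j < ?k" "i \<noteq> j" for i j using F(2) that by blast
  have Fc: "(u, v) \<in> conn (F i)" if "i < ?k" "u \<in> ?V" "v \<in> ?V" for i u v using F(3) that by blast
  \<comment> \<open>\<open>g v i\<close> will be the neighbour by which \<open>v\<close> hangs on
    the i-th tree; injectivity in \<open>i\<close> gives the trees different edges at
    \<open>v\<close>.\<close>
  have "\<exists>g. inj_on g {..<?k} \<and> g ` {..<?k} \<subseteq> nbrs E v" if "v \<in> S" for v
  proof -
    have "v < n" using that S by blast
    then have "card {..<?k} \<le> card (nbrs E v)"
      using min_degree_le[of v n E] degree_eq[OF E] by simp
    then show ?thesis using card_le_inj[OF _ finite_nbrs[OF E], of "{..<?k}"] by blast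
  qed
  then obtain g where gi: "\<And>v. v \<in> S \<Longrightarrow> inj_on (g v) {..<?k}"
    and gn: "\<And>v. v \<in> S \<Longrightarrow> g v ` {..<?k} \<subseteq> nbrs E v" by metis
  have ge: "{g v i, v} \<in> E" and gV: "g v i \<in> ?V" if "v \<in> S" "i < ?k" for v i
  proof -
    show e: "{g v i, v} \<in> E" using gn[OF that(1)] that(2) by (auto simp: nbrs_def)
    then have "g v i < n" using E all_edgesD by blast
    moreover have "g v i \<notin> S" using e ind[OF _ that(1)] by blast
    ultimately show "g v i \<in> ?V" by simp
  qed
  define C where "C i = F i \<union> (\<lambda>v. {g v i, v}) ` S" for i
  show ?thesis
  proof (rule sigma_eq_min_degree[OF n E, of C])
    fix i assume i: "i < ?k"
    have "C i \<subseteq> E" using FE[OF i] ge i by (auto simp: C_def E'_def)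
    have "\<exists>y\<in>?V. (x, y) \<in> conn (C i)" if "x < n" for x
    proof (cases "x \<in> S")
      case True
      then have "(g x i, x) \<in> conn (C i)" by (intro conn_edge) (simp add: C_def)
      then show ?thesis using gV[OF True i] conn_sym by blast
    next
      case False
      then show ?thesis using that by (intro bexI[of _ x]) auto
    qed
    moreover have "(x, y) \<in> conn (C i)" if "x \<in> ?V" "y \<in> ?V" for x y
      using conn_mono[of "F i" "C i"] Fc[OF i that] by (simp add: C_def)
    ultimately have "connected_on n (C i)"
      unfolding connected_on_def using conn_sym conn_trans by meson
    with \<open>C i \<subseteq> E\<close> show "C i \<subseteq> E \<and> connected_on n (C i)" by simp
  next
    fix i j assume ij: "i < ?k" "j < ?k" "i \<noteq> j"
    have 1: "F l \<inter> (\<lambda>v. {g v m, v}) ` S = {}" if "l < ?k" for l m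
      using FE[OF that] by (auto simp: E'_def)
    have 2: "{g v i, v} \<noteq> {g w j, w}" if vw: "v \<in> S" "w \<in> S" for v w
    proof
      \<comment> \<open>Exactly one end of each attaching edge lies in \<open>S\<close>, so equal
        edges have the same end there and the same neighbour.\<close>
      assume "{g v i, v} = {g w j, w}"
      then have "v = w \<and> g v i = g w j"
        using gV[OF vw(1) ij(1)] gV[OF vw(2) ij(2)] vw by (auto simp: doubleton_eq_iff)
      then show False using gi[OF vw(1)] ij by (auto simp: inj_on_def)
    qed
    show "C i \<inter> C j = {}"
      using Fd[OF ij] 1[OF ij(1), of j] 1[OF ij(2), of i] 2 unfolding C_def by blast
  qed
qed

section \<open>Edge counts and the deterministic criterion\<close>

definition edges_within :: "nat set \<Rightarrow> nat set set" where
  "edges_within A = {e. \<exists>a\<in>A. \<exists>b\<in>A. a \<noteq> b \<and> e = {a, b}}"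

definition edges_between :: "nat set \<Rightarrow> nat set \<Rightarrow> nat set set" where
  "edges_between A B = (\<lambda>(a, b). {a, b}) ` (A \<times> B)"

lemma card_edges_between:
  assumes "A \<inter> B = {}"
  shows "card (edges_between A B) = card A * card B"
proof -
  have "inj_on (\<lambda>(a, b). {a, b}) (A \<times> B)"
    using assms by (auto simp: inj_on_def doubleton_eq_iff)
  then show ?thesis unfolding edges_between_def by (simp add: card_image card_cartesian_product)
qed

lemma sum_nbrs_within:
  assumes E: "E \<subseteq> all_edges n" and fA: "finite A"
  shows "(\<Sum>v\<in>A. card (nbrs E v \<inter> A)) \<le> 2 * card (E \<inter> edges_within A)"
proof -
  have fE: "finite E" using E finite_all_edges finite_subset by metis
  let ?P = "SIGMA v:A. nbrs E v \<inter> A"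
  have "(\<Sum>v\<in>A. card (nbrs E v \<inter> A)) = card ?P"
    using fA by (simp add: card_SigmaI)
  \<comment> \<open>The Boolean records which of the two orientations of an edge the pair
    represents.\<close>
  also have "\<dots> \<le> card ((E \<inter> edges_within A) \<times> (UNIV :: bool set))"
  proof (rule card_inj_on_le)
    show "inj_on (\<lambda>(v, u). ({u, v}, v < u)) ?P"
      by (auto simp: inj_on_def doubleton_eq_iff)
    show "(\<lambda>(v, u). ({u, v}, v < u)) ` ?P \<subseteq> (E \<inter> edges_within A) \<times> UNIV"
      using E all_edgesD by (fastforce simp: nbrs_def edges_within_def)
    show "finite ((E \<inter> edges_within A) \<times> (UNIV :: bool set))" using fE by simp
  qed
  also have "\<dots> = 2 * card (E \<inter> edges_within A)" by (simp add: card_cartesian_product)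
  finally show ?thesis .
qed

lemma sum_nbrs_between:
  assumes E: "E \<subseteq> all_edges n" and fA: "finite A" and AB: "A \<inter> B = {}"
  shows "(\<Sum>v\<in>A. card (nbrs E v \<inter> B)) \<le> card (E \<inter> edges_between A B)"
proof -
  have fE: "finite E" using E finite_all_edges finite_subset by metis
  let ?P = "SIGMA v:A. nbrs E v \<inter> B"
  have "(\<Sum>v\<in>A. card (nbrs E v \<inter> B)) = card ?P"
    using fA finite_nbrs[OF E] by (simp add: card_SigmaI)
  also have "\<dots> \<le> card (E \<inter> edges_between A B)"
  proof (rule card_inj_on_le)
    show "inj_on (\<lambda>(v, u). {v, u}) ?P"
      using AB by (auto simp: inj_on_def doubleton_eq_iff)
    show "(\<lambda>(v, u). {v, u}) ` ?P \<subseteq> E \<inter> edges_between A B"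
      by (auto simp: nbrs_def edges_between_def insert_commute)
    show "finite (E \<inter> edges_between A B)" using fE by simp
  qed
  finally show ?thesis .
qed

text \<open>All that the random graph has to provide, as properties of a fixed graph. Cuts with a
  side of at most \<beta> n vertices are handled by adding up the degrees on that side, all others
  directly by \<open>big\<close>.\<close>

lemma sigma_eq_min_degree_if_pseudorandom:
  fixes L \<beta> :: real
  assumes S_def: "S = {v. v < n \<and> real (degree n E v) < L / 8}"
    and n: "n \<ge> 2" and L: "L \<ge> 200" and E: "E \<subseteq> all_edges n"
    and low: "min_degree n E \<le> L / 20"
    and ind: "\<And>u v. u \<in> S \<Longrightarrow> v \<in> S \<Longrightarrow> {u, v} \<notin> E"
    and far: "\<And>u v w. u \<in> S \<Longrightarrow> w \<in> S \<Longrightarrow> u \<noteq> w \<Longrightarrow> v < n \<Longrightarrow> \<not> ({u, v} \<in> E \<and> {w, v} \<in> E)"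
    and sparse: "\<And>A. A \<subseteq> {..<n} \<Longrightarrow> real (card A) \<le> \<beta> * n \<Longrightarrow>
      real (card (E \<inter> edges_within A)) \<le> card A * L / 100"
    and big: "\<And>A B. A \<subseteq> {..<n} \<Longrightarrow> B \<subseteq> {..<n} \<Longrightarrow> A \<inter> B = {} \<Longrightarrow>
      real (card A) > \<beta> * n \<Longrightarrow> real (card B) > \<beta> * n \<Longrightarrow>
      real (card (E \<inter> edges_between A B)) \<ge> L / 10"
  shows "sigma n E = min_degree n E"
proof (rule sigma_eq_min_degree_if_cuts[OF n E, of S])
  show "S \<subseteq> {..<n}" by (auto simp: S_def)
  show "{u, v} \<notin> E" if "u \<in> S" "v \<in> S" for u v using ind that by blast
  let ?V = "{..<n} - S"
  have small: "L / 10 \<le> real (card (E \<inter> edges_between A (?V - A)))"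
    if A: "A \<subseteq> ?V" "A \<noteq> {}" "real (card A) \<le> \<beta> * n" for A
  proof -
    have fA: "finite A" using A(1) finite_subset by blast
    \<comment> \<open>The 1 pays for neighbours in \<open>S\<close>: two of them would have the
      common neighbour \<open>v\<close>, against \<open>far\<close>.\<close>
    have split: "real (degree n E v) \<le> card (nbrs E v \<inter> A) + card (nbrs E v \<inter> (?V - A)) + 1"
      if v: "v \<in> A" for v
    proof -
      have vn: "v < n" using v A(1) by blast
      have fn: "finite (nbrs E v)" by (rule finite_nbrs[OF E])
      have "card (nbrs E v \<inter> S) \<le> 1"
      proof -
        have "x = y" if "x \<in> nbrs E v \<inter> S" "y \<in> nbrs E v \<inter> S" for x y
          using that far[of x y v] vn by (auto simp: nbrs_def)
        then show ?thesis using fn by (metis card_le_Suc0_iff_eq finite_Int One_nat_def)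
      qed
      moreover have "nbrs E v \<subseteq> (nbrs E v \<inter> A) \<union> (nbrs E v \<inter> (?V - A)) \<union> (nbrs E v \<inter> S)"
        using E all_edgesD by (auto simp: nbrs_def)
      then have "card (nbrs E v) \<le> card ((nbrs E v \<inter> A) \<union> (nbrs E v \<inter> (?V - A)) \<union> (nbrs E v \<inter> S))"
        using fn by (intro card_mono) auto
      moreover have "\<dots> \<le> card ((nbrs E v \<inter> A) \<union> (nbrs E v \<inter> (?V - A))) + card (nbrs E v \<inter> S)"
        by (rule card_Un_le)
      moreover have "card ((nbrs E v \<inter> A) \<union> (nbrs E v \<inter> (?V - A))) \<le>
        card (nbrs E v \<inter> A) + card (nbrs E v \<inter> (?V - A))" by (rule card_Un_le)
      ultimately show ?thesis using degree_eq[OF E, of v] by linarith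
    qed
    have "card A * (L / 8) = (\<Sum>v\<in>A. L / 8)" by simp
    also have "\<dots> \<le> (\<Sum>v\<in>A. real (card (nbrs E v \<inter> A)) + real (card (nbrs E v \<inter> (?V - A))) + 1)"
    proof (rule sum_mono)
      fix v assume v: "v \<in> A"
      then have "\<not> real (degree n E v) < L / 8" using A(1) by (auto simp: S_def)
      then show "L / 8 \<le> real (card (nbrs E v \<inter> A)) + real (card (nbrs E v \<inter> (?V - A))) + 1"
        using split[OF v] by simp
    qed
    also have "\<dots> = real (\<Sum>v\<in>A. card (nbrs E v \<inter> A)) + real (\<Sum>v\<in>A. card (nbrs E v \<inter> (?V - A))) + card A"
      by (simp add: sum.distrib)
    also have "\<dots> \<le> 2 * (card A * L / 100) + real (card (E \<inter> edges_between A (?V - A))) + card A"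
    proof -
      have "real (\<Sum>v\<in>A. card (nbrs E v \<inter> A)) \<le> 2 * real (card (E \<inter> edges_within A))"
        using sum_nbrs_within[OF E fA] by linarith
      moreover have "\<dots> \<le> 2 * (card A * L / 100)" proof -
        have "A \<subseteq> {..<n}" using A(1) by blast
        then show ?thesis using sparse[of A] A(3) by linarith
      qed
      moreover have "real (\<Sum>v\<in>A. card (nbrs E v \<inter> (?V - A))) \<le> card (E \<inter> edges_between A (?V - A))"
        using sum_nbrs_between[OF E fA, of "?V - A"] by (simp only: of_nat_le_iff) blast
      ultimately show ?thesis by linarith
    qed
    finally have "card A * (L / 8 - L / 50 - 1) \<le> card (E \<inter> edges_between A (?V - A))"
      by (simp add: algebra_simps)
    moreover have "real (card A) \<ge> 1" using A(2) fA by (simp add: Suc_le_eq card_gt_0_iff)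
    then have "1 * (L / 8 - L / 50 - 1) \<le> card A * (L / 8 - L / 50 - 1)"
      using L by (intro mult_right_mono) auto
    \<comment> \<open>The origin of \<open>L \<ge> 200\<close>: 1/8 - 1/50 - 1/10 = 1/200.\<close>
    moreover have "L / 10 \<le> 1 * (L / 8 - L / 50 - 1)" using L by simp
    ultimately show ?thesis by (meson order_trans)
  qed
  fix A assume A: "A \<subseteq> ?V" "A \<noteq> {}" "A \<noteq> ?V"
  have between: "card (E \<inter> edges_between X (?V - X)) \<le>
      card {e \<in> E. e \<inter> S = {} \<and> e \<inter> A \<noteq> {} \<and> e - A \<noteq> {}}"
    if "X = A \<or> X = ?V - A" for X
  proof (rule card_mono)
    show "finite {e \<in> E. e \<inter> S = {} \<and> e \<inter> A \<noteq> {} \<and> e - A \<noteq> {}}"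
      using finite_subset[OF E finite_all_edges] by simp
    show "E \<inter> edges_between X (?V - X) \<subseteq> {e \<in> E. e \<inter> S = {} \<and> e \<inter> A \<noteq> {} \<and> e - A \<noteq> {}}"
      using that A(1) by (auto simp: edges_between_def)
  qed
  have VA: "?V - (?V - A) = A" using A(1) by blast
  have "L / 10 \<le> real (card {e \<in> E. e \<inter> S = {} \<and> e \<inter> A \<noteq> {} \<and> e - A \<noteq> {}})"
  proof -
    \<comment> \<open>\<open>A\<close> and its complement in \<open>?V\<close> define the same cut,
      so the degree count may be run on whichever side is small.\<close>
    consider "real (card A) \<le> \<beta> * n" | "real (card (?V - A)) \<le> \<beta> * n"
      | "real (card A) > \<beta> * n" "real (card (?V - A)) > \<beta> * n" by linarith
    then obtain X where "X = A \<or> X = ?V - A" "L / 10 \<le> real (card (E \<inter> edges_between X (?V - X)))"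
    proof cases
      case 1
      then show ?thesis using small[OF A(1,2)] that[of A] by simp
    next
      case 2
      have "?V - A \<subseteq> ?V" "?V - A \<noteq> {}" using A by auto
      then show ?thesis using small[OF _ _ 2] that[of "?V - A"] by simp
    next
      case 3
      have "A \<subseteq> {..<n}" "?V - A \<subseteq> {..<n}" "A \<inter> (?V - A) = {}" using A by auto
      then show ?thesis using big[OF _ _ _ 3] that[of A] by simp
    qed
    then show ?thesis using between[of X] by linarith
  qed
  then show "2 * min_degree n E \<le> card {e \<in> E. e \<inter> S = {} \<and> e \<inter> A \<noteq> {} \<and> e - A \<noteq> {}}"
    using low by linarith
qed

section \<open>Random subsets\<close>

text \<open>The expectation of f X for the random subset X of A that contains each element independently
  with probability p.\<close>
definition expect :: "'a set \<Rightarrow> real \<Rightarrow> ('a set \<Rightarrow> real) \<Rightarrow> real" where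
  "expect A p f = (\<Sum>X\<in>Pow A. p ^ card X * (1 - p) ^ (card A - card X) * f X)"

definition prob :: "'a set \<Rightarrow> real \<Rightarrow> ('a set \<Rightarrow> bool) \<Rightarrow> real" where
  "prob A p P = expect A p (\<lambda>X. of_bool (P X))"

lemma gnp_prob_eq: "gnp_prob n p P = prob (all_edges n) p P"
  unfolding gnp_prob_def prob_def expect_def by (intro sum.cong) auto

lemma expect_empty [simp]: "expect {} p f = f {}"
  by (simp add: expect_def)

lemma expect_cong: "(\<And>X. X \<subseteq> A \<Longrightarrow> f X = g X) \<Longrightarrow> expect A p f = expect A p g"
  unfolding expect_def by (intro sum.cong) auto

lemma expect_insert:
  assumes "finite A" "x \<notin> A"
  shows "expect (insert x A) p f = (1 - p) * expect A p f + p * expect A p (\<lambda>X. f (insert x X))"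
proof -
  let ?w = "\<lambda>X. p ^ card X * (1 - p) ^ (card (insert x A) - card X) * f X"
  have inj: "inj_on (insert x) (Pow A)" using assms(2) by (auto simp: inj_on_def)
  have fX: "finite X" "card X \<le> card A" if "X \<in> Pow A" for X
    using that assms(1) finite_subset card_mono by auto
  have "expect (insert x A) p f = sum ?w (Pow A) + sum ?w (insert x ` Pow A)"
    unfolding expect_def Pow_insert using assms by (intro sum.union_disjoint) auto
  moreover have "sum ?w (Pow A) = (1 - p) * expect A p f"
    unfolding expect_def sum_distrib_left using assms fX
    by (intro sum.cong) (auto simp: Suc_diff_le algebra_simps)
  moreover have "sum ?w (insert x ` Pow A) = p * expect A p (\<lambda>X. f (insert x X))"
    unfolding expect_def sum_distrib_left sum.reindex[OF inj] comp_def
  proof (intro sum.cong refl)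
    fix X assume X: "X \<in> Pow A"
    then have "x \<notin> X" using assms(2) by blast
    then show "p ^ card (insert x X) * (1 - p) ^ (card (insert x A) - card (insert x X)) * f (insert x X)
        = p * (p ^ card X * (1 - p) ^ (card A - card X) * f (insert x X))"
      using fX[OF X] assms by simp
  qed
  ultimately show ?thesis by simp
qed

text \<open>Independence of the choices on disjoint sets, as a Fubini rule: one part of the graph
  can be exposed before the other.\<close>

lemma expect_Un:
  assumes "finite A" "finite B" "A \<inter> B = {}"
  shows "expect (A \<union> B) p f = expect A p (\<lambda>X. expect B p (\<lambda>Y. f (X \<union> Y)))"
  using assms
proof (induction A arbitrary: f rule: finite_induct)
  case (insert x A)
  have "expect (insert x (A \<union> B)) p f =
    (1 - p) * expect (A \<union> B) p f + p * expect (A \<union> B) p (\<lambda>X. f (insert x X))"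
    using insert by (intro expect_insert) auto
  then show ?case using insert by (simp add: expect_insert)
qed simp

lemma expect_mono:
  assumes "0 \<le> p" "p \<le> 1" "\<And>X. X \<subseteq> A \<Longrightarrow> f X \<le> g X"
  shows "expect A p f \<le> expect A p g"
  unfolding expect_def using assms by (intro sum_mono mult_left_mono) auto

lemma expect_const: "finite A \<Longrightarrow> expect A p (\<lambda>_. c) = c"
proof (induction A rule: finite_induct)
  case (insert x A)
  then show ?case by (simp add: expect_insert algebra_simps)
qed simp

lemma expect_cmult: "expect A p (\<lambda>X. c * f X) = c * expect A p f"
  unfolding expect_def sum_distrib_left by (intro sum.cong) auto

lemma expect_add: "expect A p (\<lambda>X. f X + g X) = expect A p f + expect A p g"
  unfolding expect_def by (simp add: sum.distrib distrib_left)

lemma expect_sum: "expect A p (\<lambda>X. \<Sum>i\<in>I. f i X) = (\<Sum>i\<in>I. expect A p (f i))"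
  unfolding expect_def sum_distrib_left by (rule sum.swap)

section \<open>Events: union bounds and exponential moments\<close>

lemma prob_mono:
  assumes "0 \<le> p" "p \<le> 1" "\<And>X. X \<subseteq> A \<Longrightarrow> P X \<Longrightarrow> Q X"
  shows "prob A p P \<le> prob A p Q"
  unfolding prob_def using assms by (intro expect_mono) auto

lemma prob_nonneg: "0 \<le> p \<Longrightarrow> p \<le> 1 \<Longrightarrow> 0 \<le> prob A p P"
  unfolding prob_def expect_def by (intro sum_nonneg) auto

lemma prob_le_1: "0 \<le> p \<Longrightarrow> p \<le> 1 \<Longrightarrow> finite A \<Longrightarrow> prob A p P \<le> 1"
  using expect_mono[of p A "\<lambda>X. of_bool (P X)" "\<lambda>_. 1"] expect_const[of A p 1] by (simp add: prob_def)

lemma prob_not: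
  assumes "finite A"
  shows "prob A p (\<lambda>X. \<not> P X) = 1 - prob A p P"
proof -
  have "prob A p (\<lambda>X. \<not> P X) + prob A p P = expect A p (\<lambda>X. 1)"
    unfolding prob_def expect_add[symmetric] by (rule expect_cong) auto
  then show ?thesis using expect_const[OF assms] by simp
qed

lemma prob_eq_0: "(\<And>X. X \<subseteq> A \<Longrightarrow> \<not> P X) \<Longrightarrow> prob A p P = 0"
  unfolding prob_def expect_def by (intro sum.neutral) auto

lemma prob_disj_le:
  assumes "0 \<le> p" "p \<le> 1"
  shows "prob A p (\<lambda>X. P X \<or> Q X) \<le> prob A p P + prob A p Q"
  unfolding prob_def expect_add[symmetric] using assms by (intro expect_mono) auto

lemma prob_Bex_le:
  assumes "0 \<le> p" "p \<le> 1" "finite I"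
  shows "prob A p (\<lambda>X. \<exists>i\<in>I. P i X) \<le> (\<Sum>i\<in>I. prob A p (P i))"
  unfolding prob_def expect_sum[symmetric]
proof (rule expect_mono[OF assms(1,2)])
  fix X
  show "of_bool (\<exists>i\<in>I. P i X) \<le> (\<Sum>i\<in>I. of_bool (P i X) :: real)"
  proof (cases "\<exists>i\<in>I. P i X")
    case True
    then obtain i where i: "i \<in> I" "P i X" by blast
    then have "of_bool (P i X) \<le> (\<Sum>i\<in>I. of_bool (P i X) :: real)"
      using assms(3) by (intro member_le_sum) auto
    then show ?thesis using True i by simp
  qed (simp add: sum_nonneg)
qed

lemma expect_power:
  assumes "finite F"
  shows "expect F p (\<lambda>X. x ^ card X) = (1 + p * (x - 1)) ^ card F"
  using assms
proof (induction F rule: finite_induct)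
  case (insert e F)
  have "expect F p (\<lambda>X. x ^ card (insert e X)) = expect F p (\<lambda>X. x * x ^ card X)"
  proof (rule expect_cong)
    fix X assume "X \<subseteq> F"
    then have "finite X" "e \<notin> X" using insert finite_subset by auto
    then show "x ^ card (insert e X) = x * x ^ card X" by simp
  qed
  then show ?case using insert by (simp add: expect_insert expect_cmult algebra_simps)
qed simp

lemma prob_subset:
  assumes "finite D"
  shows "prob D p (\<lambda>X. D \<subseteq> X) = p ^ card D"
proof -
  have "prob D p (\<lambda>X. D \<subseteq> X) = (\<Sum>X\<in>{D}. p ^ card X * (1 - p) ^ (card D - card X) * of_bool (D \<subseteq> X))"
    unfolding prob_def expect_def using assms by (intro sum.mono_neutral_right) auto
  then show ?thesis by simp
qed

text \<open>Exponential Markov inequality on top of prescribed elements \<open>D\<close>. The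
  indicator of \<open>P\<close> is at most \<open>c\<close> times that of D \<subseteq> X times x ^
  card (X \<inter> F); as \<open>D\<close> and \<open>F\<close> are disjoint, the expectation
  factors, and 1 + y \<le> exp y does the rest. Taking x < 1 gives lower tails and x > 1 upper
  tails, with the threshold absorbed into \<open>c\<close>.\<close>

lemma prob_markov:
  assumes p: "0 \<le> p" "p \<le> 1" and A: "finite A" "D \<subseteq> A" "F \<subseteq> A" "D \<inter> F = {}"
    and x: "x \<ge> 0" and c: "c \<ge> 0"
    and P: "\<And>X. X \<subseteq> A \<Longrightarrow> P X \<Longrightarrow> D \<subseteq> X \<and> 1 \<le> c * x ^ card (X \<inter> F)"
  shows "prob A p P \<le> c * p ^ card D * exp (p * (x - 1) * card F)"
proof -
  define R where "R = A - (D \<union> F)"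
  have fin: "finite D" "finite F" "finite R" using A finite_subset by (auto simp: R_def)
  have AR: "A = D \<union> (F \<union> R)" using A by (auto simp: R_def)
  let ?f = "\<lambda>X. of_bool (D \<subseteq> X) * x ^ card (X \<inter> F)"
  have "expect A p ?f = expect D p (\<lambda>X. expect F p (\<lambda>Y. expect R p (\<lambda>Z. ?f (X \<union> (Y \<union> Z)))))"
    unfolding AR using fin A(4)
    by (subst expect_Un, simp, simp, force simp: R_def, subst expect_Un) (auto simp: R_def)
  also have "\<dots> = expect D p (\<lambda>X. expect F p (\<lambda>Y. expect R p (\<lambda>Z. of_bool (D \<subseteq> X) * x ^ card Y)))"
  proof (intro expect_cong)
    fix X Y Z assume "X \<subseteq> D" "Y \<subseteq> F" "Z \<subseteq> R"
    then have "(X \<union> (Y \<union> Z)) \<inter> F = Y" "D \<subseteq> X \<union> (Y \<union> Z) \<longleftrightarrow> D \<subseteq> X"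
      using A(4) unfolding R_def by blast+
    then show "?f (X \<union> (Y \<union> Z)) = of_bool (D \<subseteq> X) * x ^ card Y" by simp
  qed
  also have "\<dots> = p ^ card D * (1 + p * (x - 1)) ^ card F"
  proof -
    have "expect D p (\<lambda>X. of_bool (D \<subseteq> X) * c) = p ^ card D * c" for c
      using prob_subset[OF fin(1), of p] expect_cmult[of D p c "\<lambda>X. of_bool (D \<subseteq> X)"]
      by (simp add: prob_def mult.commute)
    then show ?thesis by (simp only: expect_const[OF fin(3)] expect_cmult expect_power[OF fin(2)])
  qed
  finally have eq: "expect A p ?f = p ^ card D * (1 + p * (x - 1)) ^ card F" .
  have "0 \<le> p * x + (1 - p)" using p x by simp
  then have "0 \<le> 1 + p * (x - 1)" by (simp add: algebra_simps)
  then have "(1 + p * (x - 1)) ^ card F \<le> exp (p * (x - 1)) ^ card F"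
    by (intro power_mono exp_ge_add_one_self)
  also have "\<dots> = exp (p * (x - 1) * card F)"
    by (simp add: exp_of_nat_mult[symmetric] mult.commute)
  finally have le: "(1 + p * (x - 1)) ^ card F \<le> exp (p * (x - 1) * card F)" .
  have "prob A p P \<le> expect A p (\<lambda>X. c * ?f X)"
    unfolding prob_def using P c x by (intro expect_mono p) auto
  also have "\<dots> = c * (p ^ card D * (1 + p * (x - 1)) ^ card F)" by (simp only: expect_cmult eq)
  also have "\<dots> \<le> c * (p ^ card D * exp (p * (x - 1) * card F))"
    using le c p by (intro mult_left_mono) auto
  finally show ?thesis by (simp add: mult.assoc)
qed

lemma prob_Ball_disjoint:
  assumes "finite I" "\<And>i. i \<in> I \<Longrightarrow> finite (St i)"
    "\<And>i j. i \<in> I \<Longrightarrow> j \<in> I \<Longrightarrow> i \<noteq> j \<Longrightarrow> St i \<inter> St j = {}"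
  shows "prob (\<Union>i\<in>I. St i) p (\<lambda>X. \<forall>i\<in>I. Q (X \<inter> St i)) = (\<Prod>i\<in>I. prob (St i) p Q)"
  using assms
proof (induction I rule: finite_induct)
  case empty
  then show ?case by (simp add: prob_def)
next
  case (insert i I)
  let ?U = "\<Union>j\<in>I. St j"
  have d: "St i \<inter> ?U = {}" using insert by blast
  have "prob (St i \<union> ?U) p (\<lambda>X. \<forall>i\<in>insert i I. Q (X \<inter> St i)) =
    expect (St i) p (\<lambda>X. expect ?U p (\<lambda>Y. of_bool (\<forall>j\<in>insert i I. Q ((X \<union> Y) \<inter> St j))))"
    unfolding prob_def using insert d by (intro expect_Un) auto
  also have "\<dots> = expect (St i) p (\<lambda>X. expect ?U p (\<lambda>Y. of_bool (Q X) * of_bool (\<forall>j\<in>I. Q (Y \<inter> St j))))"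
  proof (intro expect_cong)
    fix X Y assume XY: "X \<subseteq> St i" "Y \<subseteq> ?U"
    have "(X \<union> Y) \<inter> St i = X" using XY d by blast
    moreover have "(X \<union> Y) \<inter> St j = Y \<inter> St j" if "j \<in> I" for j using XY d that by blast
    ultimately show "of_bool (\<forall>j\<in>insert i I. Q ((X \<union> Y) \<inter> St j)) =
        (of_bool (Q X) * of_bool (\<forall>j\<in>I. Q (Y \<inter> St j)) :: real)" by auto
  qed
  also have "\<dots> = prob ?U p (\<lambda>Y. \<forall>j\<in>I. Q (Y \<inter> St j)) * prob (St i) p Q"
    unfolding expect_cmult prob_def by (subst expect_cmult[symmetric]) (simp add: mult.commute)
  finally show ?case using insert by (simp add: mult.commute)
qed

lemma prob_card_eq:
  fixes p :: real
  assumes "finite A"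
  shows "prob A p (\<lambda>X. card X = m) = (card A choose m) * p ^ m * (1 - p) ^ (card A - m)"
proof -
  have "prob A p (\<lambda>X. card X = m) = (\<Sum>X\<in>{X. X \<subseteq> A \<and> card X = m}. p ^ m * (1 - p) ^ (card A - m))"
    unfolding prob_def expect_def using assms by (intro sum.mono_neutral_cong_right) auto
  then show ?thesis using n_subsets[OF assms, of m] by simp
qed

section \<open>Subset sums, sets of possible edges, and bounds for ln 2\<close>

lemma sum_power_card:
  assumes "finite V"
  shows "(\<Sum>A\<in>Pow V. x ^ card A) = (1 + x :: real) ^ card V"
  using prod_add[OF assms, of "\<lambda>_. x" "\<lambda>_. 1"] by (simp add: add.commute)

lemma no_loop: "E \<subseteq> all_edges n \<Longrightarrow> {x} \<in> E \<Longrightarrow> False"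
  using all_edgesD[of x x n] by auto

lemma edges_within_subset:
  assumes "A \<subseteq> {..<n}"
  shows "edges_within A \<subseteq> all_edges n"
proof
  fix e assume "e \<in> edges_within A"
  then obtain a b where "a \<in> A" "b \<in> A" "a \<noteq> b" "e = {a, b}" unfolding edges_within_def by blast
  then show "e \<in> all_edges n" using assms all_edgesI[of a n b] by auto
qed

lemma edges_between_subset:
  assumes "A \<subseteq> {..<n}" "B \<subseteq> {..<n}" "A \<inter> B = {}"
  shows "edges_between A B \<subseteq> all_edges n"
proof
  fix e assume "e \<in> edges_between A B"
  then obtain a b where ab: "a \<in> A" "b \<in> B" "e = {a, b}" unfolding edges_between_def by auto
  then have "a < n" "b < n" "a \<noteq> b" using assms by auto
  then show "e \<in> all_edges n" using ab all_edgesI by simp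
qed

lemma card_edges_within_le:
  assumes "finite A"
  shows "card (edges_within A) \<le> card A * card A"
proof -
  have "edges_within A \<subseteq> (\<lambda>(a, b). {a, b}) ` (A \<times> A)" by (auto simp: edges_within_def)
  then have "card (edges_within A) \<le> card ((\<lambda>(a, b). {a, b}) ` (A \<times> A))"
    using assms by (intro card_mono) auto
  also have "\<dots> \<le> card (A \<times> A)" using assms by (intro card_image_le) auto
  finally show ?thesis by (simp add: card_cartesian_product)
qed

text \<open>Writes 2 = (4/3)(3/2) and applies ln x \<le> x - 1 to the reciprocals, so 1/4 + 1/3 =
  7/12. It yields ln 16 \<ge> 7/3, on which the exponent 59/60 rests.\<close>

lemma ln_2_lower: "7/12 \<le> ln (2::real)"
proof -
  have "ln (3/4) = ln 3 - 2 * ln (2::real)" using ln_realpow[of 2 2] by (simp add: ln_div)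
  moreover have "ln (2/3) = ln (2::real) - ln 3" by (simp add: ln_div)
  moreover have "ln (3/4) \<le> 3/4 - (1::real)" "ln (2/3) \<le> 2/3 - (1::real)"
    by (intro ln_le_minus_one; simp)+
  ultimately show ?thesis by linarith
qed

lemma ln_2_upper: "ln (2::real) \<le> 11/15"
proof -
  have "(2::real) \<le> (1 + 11/30 + (11/30)^2 / 2) ^ 2" by (simp add: power2_eq_square)
  also have "\<dots> \<le> exp (11/30) ^ 2" by (intro power_mono exp_lower_Taylor_quadratic) auto
  also have "\<dots> = exp (11/15)" by (simp add: exp_of_nat_mult[symmetric])
  finally have "ln 2 \<le> ln (exp (11/15 :: real))" by (subst ln_le_cancel_iff) auto
  then show ?thesis by simp
qed

section \<open>Properties of the random graph\<close>

text \<open>A lower tail for the edges from {u, w} to the vertices other than u, w, v. Leaving out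
  the edges inside {u, w, v} makes these independent of \<open>D\<close>, which will be the edge uw
  or the path u, v, w.\<close>

lemma prob_two_low_degrees:
  fixes L p :: real
  assumes p: "0 \<le> p" "p \<le> 1" and L: "L \<le> n * p" "0 \<le> L"
    and uwv: "u < n" "w < n" "u \<noteq> w" "v < n"
    and D: "D \<subseteq> all_edges n" "D \<subseteq> Pow {u, w, v}"
  shows "prob (all_edges n) p (\<lambda>E. D \<subseteq> E \<and> real (degree n E u) < L / 8 \<and> real (degree n E w) < L / 8)
    \<le> p ^ card D * exp (6 - 1.2 * L)"
proof -
  define F where "F = edges_between {u, w} ({..<n} - {u, w, v})"
  have sub: "F \<subseteq> all_edges n" unfolding F_def using uwv by (intro edges_between_subset) auto
  have DF: "D \<inter> F = {}" using D(2) by (auto simp: F_def edges_between_def)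
  define W where "W = {..<n} - {u, w, v}"
  have "card {..<n} \<le> card (W \<union> {u, w, v})" by (intro card_mono) (auto simp: W_def)
  also have "\<dots> \<le> card W + card {u, w, v}" by (rule card_Un_le)
  also have "\<dots> \<le> card W + 3" by (simp add: card_insert_if)
  finally have "n \<le> card W + 3" by simp
  moreover have "card F = 2 * card W"
    unfolding F_def W_def using uwv(3) by (subst card_edges_between) auto
  ultimately have cF: "real (card F) \<ge> 2 * (real n - 3)" by simp
  have "prob (all_edges n) p (\<lambda>E. D \<subseteq> E \<and> real (degree n E u) < L / 8 \<and> real (degree n E w) < L / 8)
    \<le> exp (L / 4 * ln 8) * p ^ card D * exp (p * (1/8 - 1) * card F)"
  proof (rule prob_markov[OF p finite_all_edges D(1) sub DF])
    fix X assume X: "X \<subseteq> all_edges n"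
      and h: "D \<subseteq> X \<and> real (degree n X u) < L / 8 \<and> real (degree n X w) < L / 8"
    have "X \<inter> F \<subseteq> (\<lambda>y. {y, u}) ` nbrs X u \<union> (\<lambda>y. {y, w}) ` nbrs X w"
      by (auto simp: F_def edges_between_def nbrs_def insert_commute)
    then have "card (X \<inter> F) \<le> card ((\<lambda>y. {y, u}) ` nbrs X u \<union> (\<lambda>y. {y, w}) ` nbrs X w)"
      using finite_nbrs[OF X] by (intro card_mono) auto
    also have "\<dots> \<le> card ((\<lambda>y. {y, u}) ` nbrs X u) + card ((\<lambda>y. {y, w}) ` nbrs X w)"
      by (rule card_Un_le)
    also have "\<dots> \<le> card (nbrs X u) + card (nbrs X w)"
      using finite_nbrs[OF X] by (intro add_mono card_image_le) auto
    finally have "real (card (X \<inter> F)) \<le> L / 4" using h degree_eq[OF X] by simp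
    then have "real (card (X \<inter> F)) * ln 8 \<le> L / 4 * ln 8" by (intro mult_right_mono) auto
    then have "exp (real (card (X \<inter> F)) * ln 8) \<le> exp (L / 4 * ln 8)" by simp
    moreover have "exp (real (card (X \<inter> F)) * ln 8) = 8 ^ card (X \<inter> F)"
      by (simp add: exp_of_nat_mult)
    ultimately have "(8::real) ^ card (X \<inter> F) \<le> exp (L / 4 * ln 8)" by simp
    then show "D \<subseteq> X \<and> 1 \<le> exp (L / 4 * ln 8) * (1/8) ^ card (X \<inter> F)"
      using h by (simp add: power_divide)
  qed auto
  also have "\<dots> = p ^ card D * exp (L / 4 * ln 8 + p * (1/8 - 1) * card F)"
    by (simp only: exp_add mult_ac)
  also have "\<dots> \<le> p ^ card D * exp (6 - 1.2 * L)"
  proof (intro mult_left_mono)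
    \<comment> \<open>The threshold costs at most (L/4) * 3 * (11/15) = 0.55 L, the moment gains
      (7/8) * 2 L = 1.75 L, and the difference is 1.2 L. The 6 covers the omitted vertices.\<close>
    have "ln 8 = 3 * ln (2::real)" using ln_realpow[of 2 3] by simp
    then have "L / 4 * ln 8 \<le> L / 4 * (3 * (11 / 15))"
      using L ln_2_upper by (intro mult_left_mono) auto
    moreover have "p * (2 * (real n - 3)) \<le> p * card F" using cF p by (intro mult_left_mono)
    moreover have "p * (1/8 - 1) * card F = - (7/8) * (p * card F)" by simp
    moreover have "p * (2 * (real n - 3)) = 2 * (n * p) - 6 * p" by (simp add: algebra_simps)
    ultimately have "L / 4 * ln 8 + p * (1/8 - 1) * card F \<le> 6 - 1.2 * L" using L p by linarith
    then show "exp (L / 4 * ln 8 + p * (1/8 - 1) * card F) \<le> exp (6 - 1.2 * L)" by simp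
  qed (use p in auto)
  finally show ?thesis .
qed

lemma prob_adjacent_low_degrees:
  fixes L p :: real
  assumes p: "0 \<le> p" "p \<le> 1" and L: "L \<le> n * p" "0 \<le> L"
  shows "prob (all_edges n) p (\<lambda>E. \<exists>(u, w)\<in>{..<n} \<times> {..<n}. {u, w} \<in> E \<and>
      real (degree n E u) < L / 8 \<and> real (degree n E w) < L / 8)
    \<le> real n ^ 2 * p * exp (6 - 1.2 * L)" (is "prob _ _ (\<lambda>E. \<exists>(u, w)\<in>_. ?Q u w E) \<le> _")
proof -
  have "prob (all_edges n) p (\<lambda>E. \<exists>i\<in>{..<n} \<times> {..<n}. case i of (u, w) \<Rightarrow> ?Q u w E)
    \<le> (\<Sum>i\<in>{..<n} \<times> {..<n}. prob (all_edges n) p (\<lambda>E. case i of (u, w) \<Rightarrow> ?Q u w E))"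
    by (rule prob_Bex_le[OF p]) auto
  also have "\<dots> \<le> (\<Sum>i\<in>{..<n} \<times> {..<n}. p * exp (6 - 1.2 * L))"
  proof (rule sum_mono)
    fix i assume i: "i \<in> {..<n} \<times> {..<n}"
    obtain u w where [simp]: "i = (u, w)" by (cases i)
    show "prob (all_edges n) p (\<lambda>E. case i of (u, w) \<Rightarrow> ?Q u w E) \<le> p * exp (6 - 1.2 * L)"
    proof (cases "u = w")
      case True
      then have "prob (all_edges n) p (?Q u w) = 0" by (intro prob_eq_0) (auto dest: no_loop)
      then show ?thesis using p by simp
    next
      case False
      \<comment> \<open>Here no third vertex is involved, so \<open>v\<close> is instantiated with
        \<open>u\<close>.\<close>
      then have "prob (all_edges n) p (\<lambda>E. {{u, w}} \<subseteq> E \<and> real (degree n E u) < L / 8 \<and> real (degree n E w) < L / 8)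
          \<le> p ^ card {{u, w}} * exp (6 - 1.2 * L)"
        using i by (intro prob_two_low_degrees[OF p L, where v = u]) (auto intro: all_edgesI)
      then show ?thesis by simp
    qed
  qed
  also have "\<dots> = real n ^ 2 * p * exp (6 - 1.2 * L)" by (simp add: power2_eq_square)
  finally show ?thesis .
qed

lemma prob_common_neighbour_low_degrees:
  fixes L p :: real
  assumes p: "0 \<le> p" "p \<le> 1" and L: "L \<le> n * p" "0 \<le> L"
  shows "prob (all_edges n) p (\<lambda>E. \<exists>(u, w, v)\<in>{..<n} \<times> {..<n} \<times> {..<n}. u \<noteq> w \<and> {u, v} \<in> E \<and> {w, v} \<in> E \<and>
      real (degree n E u) < L / 8 \<and> real (degree n E w) < L / 8)
    \<le> real n ^ 3 * p ^ 2 * exp (6 - 1.2 * L)" (is "prob _ _ (\<lambda>E. \<exists>(u, w, v)\<in>_. ?Q u w v E) \<le> _")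
proof -
  let ?I = "{..<n} \<times> {..<n} \<times> {..<n}"
  have "prob (all_edges n) p (\<lambda>E. \<exists>i\<in>?I. case i of (u, w, v) \<Rightarrow> ?Q u w v E)
    \<le> (\<Sum>i\<in>?I. prob (all_edges n) p (\<lambda>E. case i of (u, w, v) \<Rightarrow> ?Q u w v E))"
    by (rule prob_Bex_le[OF p]) auto
  also have "\<dots> \<le> (\<Sum>i\<in>?I. p ^ 2 * exp (6 - 1.2 * L))"
  proof (rule sum_mono)
    fix i assume i: "i \<in> ?I"
    obtain u w v where [simp]: "i = (u, w, v)" by (cases i)
    show "prob (all_edges n) p (\<lambda>E. case i of (u, w, v) \<Rightarrow> ?Q u w v E) \<le> p ^ 2 * exp (6 - 1.2 * L)"
    proof (cases "u = w \<or> u = v \<or> w = v")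
      case True
      then have "prob (all_edges n) p (?Q u w v) = 0" by (intro prob_eq_0) (auto dest: no_loop)
      then show ?thesis using p by simp
    next
      case False
      let ?D = "{{u, v}, {w, v}}"
      have c: "card ?D = 2" using False by (simp add: doubleton_eq_iff card_insert_if)
      have "prob (all_edges n) p (?Q u w v) \<le>
          prob (all_edges n) p (\<lambda>E. ?D \<subseteq> E \<and> real (degree n E u) < L / 8 \<and> real (degree n E w) < L / 8)"
        by (intro prob_mono[OF p]) auto
      also have "\<dots> \<le> p ^ card ?D * exp (6 - 1.2 * L)"
        using i False by (intro prob_two_low_degrees[OF p L, where v = v]) (auto intro: all_edgesI)
      finally show ?thesis unfolding c by simp
    qed
  qed
  also have "\<dots> = real n ^ 3 * p ^ 2 * exp (6 - 1.2 * L)" by (simp add: power3_eq_cube card_cartesian_product)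
  finally show ?thesis .
qed

text \<open>The tilt exp 300 turns the threshold into a factor exp (- 3 L card A). Its price is an
  exponent p exp 300 (card A)^2, and \<beta> is chosen so that this is at most (n p / 2) card A
  \<le> L card A. A factor exp (- 2 L) remains for each vertex of \<open>A\<close>, strong enough
  for a union bound over all sets.\<close>

lemma prob_dense_small_set:
  fixes L p \<beta> :: real
  assumes p: "0 \<le> p" "p \<le> 1" and L: "n * p \<le> 1.1 * L" "0 \<le> L" and \<beta>: "\<beta> = exp (-300) / 2"
  shows "prob (all_edges n) p (\<lambda>E. \<exists>A\<in>{A. A \<subseteq> {..<n} \<and> A \<noteq> {} \<and> real (card A) \<le> \<beta> * n}.
      real (card (E \<inter> edges_within A)) > card A * L / 100)
    \<le> (1 + exp (- 2 * L)) ^ n - 1"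
proof -
  let ?I = "{A. A \<subseteq> {..<n} \<and> A \<noteq> {} \<and> real (card A) \<le> \<beta> * n}"
  have fI: "finite ?I" by (rule finite_subset[of _ "Pow {..<n}"]) auto
  have "prob (all_edges n) p (\<lambda>E. \<exists>A\<in>?I. real (card (E \<inter> edges_within A)) > card A * L / 100)
    \<le> (\<Sum>A\<in>?I. prob (all_edges n) p (\<lambda>E. real (card (E \<inter> edges_within A)) > card A * L / 100))"
    by (rule prob_Bex_le[OF p fI])
  also have "\<dots> \<le> (\<Sum>A\<in>?I. exp (- 2 * L) ^ card A)"
  proof (rule sum_mono)
    fix A assume A: "A \<in> ?I"
    then have fA: "finite A" using finite_subset by blast
    have "prob (all_edges n) p (\<lambda>E. real (card (E \<inter> edges_within A)) > card A * L / 100)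
      \<le> exp (- 3 * L * card A) * p ^ card ({} :: nat set set) * exp (p * (exp 300 - 1) * card (edges_within A))"
    proof (rule prob_markov[OF p finite_all_edges])
      show "edges_within A \<subseteq> all_edges n" using A by (intro edges_within_subset) auto
      fix X assume "real (card (X \<inter> edges_within A)) > card A * L / 100"
      then have "0 \<le> - 3 * L * card A + real (card (X \<inter> edges_within A)) * 300" by (simp add: algebra_simps)
      then have "1 \<le> exp (- 3 * L * card A + real (card (X \<inter> edges_within A)) * 300)" by simp
      also have "\<dots> = exp (- 3 * L * card A) * exp 300 ^ card (X \<inter> edges_within A)"
        by (simp only: exp_add exp_of_nat_mult)
      finally show "{} \<subseteq> X \<and> 1 \<le> exp (- 3 * L * card A) * exp 300 ^ card (X \<inter> edges_within A)" by simp
    qed auto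
    also have "\<dots> = exp (- 3 * L * card A + p * (exp 300 - 1) * card (edges_within A))"
      by (simp only: exp_add card.empty power_0 mult_1_right)
    also have "\<dots> \<le> exp (- 2 * L * card A)"
    proof -
      have "p * (exp 300 - 1) * card (edges_within A) \<le> p * exp 300 * (card A * card A)"
      proof (rule mult_mono)
        show "real (card (edges_within A)) \<le> real (card A * card A)"
          using card_edges_within_le[OF fA] by (simp only: of_nat_le_iff)
      qed (use p in \<open>auto simp: mult_left_mono\<close>)
      also have "\<dots> = p * exp 300 * card A * card A" by simp
      also have "\<dots> \<le> p * exp 300 * card A * (\<beta> * n)"
        using A p by (intro mult_left_mono) auto
      also have "\<dots> = n * p / 2 * card A" by (simp add: \<beta> exp_minus)
      also have "\<dots> \<le> L * card A" using L by (intro mult_right_mono) auto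
      finally show ?thesis by (simp add: algebra_simps)
    qed
    also have "\<dots> = exp (- 2 * L) ^ card A" by (simp only: exp_of_nat2_mult)
    finally show "prob (all_edges n) p (\<lambda>E. real (card (E \<inter> edges_within A)) > card A * L / 100)
      \<le> exp (- 2 * L) ^ card A" .
  qed
  \<comment> \<open>Without the size restriction the sum over all sets has a closed form; the empty
    set accounts for the - 1.\<close>
  also have "\<dots> \<le> (\<Sum>A\<in>Pow {..<n} - {{}}. exp (- 2 * L) ^ card A)"
    by (intro sum_mono2) auto
  also have "\<dots> = (\<Sum>A\<in>Pow {..<n}. exp (- 2 * L) ^ card A) - 1"
    by (subst sum_diff1) auto
  also have "\<dots> = (1 + exp (- 2 * L)) ^ n - 1" by (subst sum_power_card) auto
  finally show ?thesis .
qed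

text \<open>There are at most 4^n pairs of sets, and at least \<beta>^2 n L edges are expected
  between the sets of each pair. With L growing, a failure probability exponential in n L outweighs
  4^n, so the crude factor exp L for the threshold L/10 is harmless.\<close>

lemma prob_sparse_cut:
  fixes L p \<beta> :: real
  assumes p: "0 \<le> p" "p \<le> 1" and L: "L \<le> n * p" "0 \<le> L" and \<beta>: "\<beta> > 0"
  shows "prob (all_edges n) p (\<lambda>E. \<exists>(A, B)\<in>{(A, B). A \<subseteq> {..<n} \<and> B \<subseteq> {..<n} \<and> A \<inter> B = {} \<and>
      real (card A) > \<beta> * n \<and> real (card B) > \<beta> * n}. real (card (E \<inter> edges_between A B)) < L / 10)
    \<le> 4 ^ n * exp (L - \<beta> ^ 2 / 2 * n * L)"
proof -
  let ?I = "{(A, B). A \<subseteq> {..<n} \<and> B \<subseteq> {..<n} \<and> A \<inter> B = {} \<and>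
      real (card A) > \<beta> * n \<and> real (card B) > \<beta> * n}"
  let ?Q = "\<lambda>E A B. real (card (E \<inter> edges_between A B)) < L / 10"
  have sI: "?I \<subseteq> Pow {..<n} \<times> Pow {..<n}" by auto
  then have fI: "finite ?I" by (rule finite_subset) auto
  have "card ?I \<le> card (Pow {..<n} \<times> Pow {..<n})" using sI by (intro card_mono) auto
  also have "\<dots> = 4 ^ n" by (simp add: card_cartesian_product card_Pow power_mult_distrib[symmetric])
  finally have "card ?I \<le> 4 ^ n" .
  then have "real (card ?I) \<le> real (4 ^ n)" by (simp only: of_nat_le_iff)
  then have cI: "real (card ?I) \<le> 4 ^ n" by simp
  have "prob (all_edges n) p (\<lambda>E. \<exists>i\<in>?I. case i of (A, B) \<Rightarrow> ?Q E A B)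
    \<le> (\<Sum>i\<in>?I. prob (all_edges n) p (\<lambda>E. case i of (A, B) \<Rightarrow> ?Q E A B))"
    by (rule prob_Bex_le[OF p fI])
  also have "\<dots> \<le> (\<Sum>i\<in>?I. exp (L - \<beta> ^ 2 / 2 * n * L))"
  proof (rule sum_mono)
    fix i assume i: "i \<in> ?I"
    obtain A B where [simp]: "i = (A, B)" by (cases i)
    have AB: "A \<subseteq> {..<n}" "B \<subseteq> {..<n}" "A \<inter> B = {}" "real (card A) > \<beta> * n" "real (card B) > \<beta> * n"
      using i by auto
    let ?F = "edges_between A B"
    have "prob (all_edges n) p (\<lambda>E. ?Q E A B)
      \<le> exp L * p ^ card ({} :: nat set set) * exp (p * (exp (-1) - 1) * card ?F)"
    proof (rule prob_markov[OF p finite_all_edges])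
      show "?F \<subseteq> all_edges n" using AB by (intro edges_between_subset)
      fix X assume "?Q X A B"
      then have "1 \<le> exp (L + real (card (X \<inter> ?F)) * (-1))" using L by simp
      also have "\<dots> = exp L * exp (-1) ^ card (X \<inter> ?F)"
        by (simp only: exp_add exp_of_nat_mult)
      finally show "{} \<subseteq> X \<and> 1 \<le> exp L * exp (-1) ^ card (X \<inter> ?F)" by simp
    qed auto
    also have "\<dots> = exp (L - (1 - exp (-1)) * (p * card ?F))" by (simp add: exp_diff exp_minus field_simps flip: exp_add)
    also have "\<dots> \<le> exp (L - \<beta> ^ 2 / 2 * n * L)"
    proof -
      have "exp (-1) \<le> (1/2 :: real)"
        using exp_ge_add_one_self[of 1] by (simp add: exp_minus field_simps)
      then have e: "1/2 \<le> 1 - exp (-1 :: real)" by linarith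
      have "\<beta> * n * (\<beta> * n) \<le> real (card A) * real (card B)"
        using AB \<beta> by (intro mult_mono) auto
      then have "p * (\<beta> * n * (\<beta> * n)) \<le> p * card ?F"
        unfolding card_edges_between[OF AB(3)] using p by (intro mult_left_mono) auto
      moreover have "p * (\<beta> * n * (\<beta> * n)) = \<beta> ^ 2 * n * (n * p)" by (simp add: power2_eq_square)
      moreover have "\<beta> ^ 2 * n * L \<le> \<beta> ^ 2 * n * (n * p)" using L by (intro mult_left_mono) auto
      ultimately have "\<beta> ^ 2 * n * L \<le> p * card ?F" by linarith
      moreover have "1/2 * (p * card ?F) \<le> (1 - exp (-1)) * (p * card ?F)"
        using e p by (intro mult_right_mono) auto
      ultimately show ?thesis by simp
    qed
    finally show "prob (all_edges n) p (\<lambda>E. case i of (A, B) \<Rightarrow> ?Q E A B) \<le> exp (L - \<beta> ^ 2 / 2 * n * L)"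
      by simp
  qed
  also have "\<dots> = card ?I * exp (L - \<beta> ^ 2 / 2 * n * L)" by simp
  also have "\<dots> \<le> 4 ^ n * exp (L - \<beta> ^ 2 / 2 * n * L)" using cI by (intro mult_right_mono) auto
  finally show ?thesis .
qed

text \<open>The degrees of the vertices below s into the complement of {..<s} are independent. If one of
  them is at most m, then exposing the remaining edges is unlikely to increase it.\<close>
lemma prob_no_low_degree:
  fixes p :: real
  assumes p: "0 \<le> p" "p \<le> 1" and s: "s \<le> n"
  shows "prob (all_edges n) p (\<lambda>E. \<forall>v<n. degree n E v > m)
    \<le> (1 - real ((n - s) choose m) * p ^ m * (1 - p) ^ (n - s - m)) ^ s + s * p"
proof -
  define St where "St v = edges_between {v} {s..<n}" for v
  define A where "A = (\<Union>v\<in>{..<s}. St v)"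
  define B where "B = all_edges n - A"
  let ?q = "real ((n - s) choose m) * p ^ m * (1 - p) ^ (n - s - m)"
  have mem: "{v, w} \<in> St v" if "s \<le> w" "w < n" for v w
    using that unfolding St_def edges_between_def by force
  have StD: "\<exists>w. s \<le> w \<and> w < n \<and> e = {v, w}" if "e \<in> St v" for e v
    using that unfolding St_def edges_between_def by auto
  have St_sub: "St v \<subseteq> all_edges n" if "v < s" for v
    unfolding St_def using that s by (intro edges_between_subset) auto
  have fSt: "finite (St v)" for v unfolding St_def edges_between_def by simp
  have dSt: "St v \<inter> St w = {}" if "v < s" "w < s" "v \<noteq> w" for v w
    using that StD[of _ v] StD[of _ w] by (fastforce simp: doubleton_eq_iff)
  have cSt: "card (St v) = n - s" if "v < s" for v
    unfolding St_def using that by (subst card_edges_between) auto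
  have AB: "all_edges n = A \<union> B" "A \<inter> B = {}" "finite A" "finite B"
    using St_sub finite_all_edges[of n] finite_subset[of A "all_edges n"] by (auto simp: A_def B_def)
  have single: "prob (St v) p (\<lambda>X. \<not> card X \<le> m) \<le> 1 - ?q" if "v < s" for v
  proof -
    \<comment> \<open>The single value \<open>m\<close> is already likely enough, so no binomial sum
      has to be estimated.\<close>
    have "?q = prob (St v) p (\<lambda>X. card X = m)" using prob_card_eq[OF fSt, of v p m] cSt[OF that] by simp
    also have "\<dots> \<le> prob (St v) p (\<lambda>X. card X \<le> m)" by (intro prob_mono[OF p]) simp
    finally show ?thesis using prob_not[OF fSt, of v p "\<lambda>X. card X \<le> m"] by simp
  qed
  \<comment> \<open>If the star of \<open>v\<close> has at most \<open>m\<close> edges, then a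
    degree above \<open>m\<close> forces an edge from \<open>v\<close> to some vertex below
    \<open>s\<close>; a union bound over these gives s p.\<close>
  have later: "prob B p (\<lambda>Y. \<forall>v<n. degree n (X \<union> Y) v > m) \<le> s * p"
    if X: "X \<subseteq> A" and v: "v < s" "card (X \<inter> St v) \<le> m" for X v
  proof -
    have "prob B p (\<lambda>Y. \<forall>v<n. degree n (X \<union> Y) v > m) \<le> prob B p (\<lambda>Y. \<exists>w\<in>{..<s}. {v, w} \<in> Y)"
    proof (rule prob_mono[OF p])
      fix Y assume Y: "Y \<subseteq> B" and deg: "\<forall>v<n. degree n (X \<union> Y) v > m"
      show "\<exists>w\<in>{..<s}. {v, w} \<in> Y"
      proof (rule ccontr)
        assume no: "\<not> (\<exists>w\<in>{..<s}. {v, w} \<in> Y)"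
        have sub: "X \<union> Y \<subseteq> all_edges n" using X Y AB(1) by blast
        have "{w, v} \<in> X \<inter> St v" if "{w, v} \<in> X \<union> Y" for w
        proof -
          have w: "w < n" using all_edgesD sub that by blast
          have "s \<le> w \<or> {w, v} \<in> X" using no that by (auto simp: insert_commute not_le)
          moreover have "s \<le> w" if wX: "{w, v} \<in> X"
          proof -
            obtain u where u: "u < s" "{w, v} \<in> St u" using wX X unfolding A_def by blast
            then obtain x where "s \<le> x" "{w, v} = {u, x}" using StD by blast
            then show ?thesis using v u by (auto simp: doubleton_eq_iff)
          qed
          ultimately have "s \<le> w" by blast
          then have St: "{w, v} \<in> St v" using mem[of w v] w by (simp add: insert_commute)
          then have "{w, v} \<in> A" using v by (auto simp: A_def)
          then have "{w, v} \<in> X" using that Y by (auto simp: B_def)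
          then show ?thesis using St by simp
        qed
        then have "(\<lambda>w. {w, v}) ` nbrs (X \<union> Y) v \<subseteq> X \<inter> St v" by (auto simp: nbrs_def)
        moreover have "inj_on (\<lambda>w. {w, v}) (nbrs (X \<union> Y) v)" by (auto simp: inj_on_def doubleton_eq_iff)
        ultimately have "card (nbrs (X \<union> Y) v) \<le> card (X \<inter> St v)"
          using fSt by (intro card_inj_on_le) auto
        moreover have "degree n (X \<union> Y) v > m" using deg v s by simp
        ultimately show False using v degree_eq[OF sub] by simp
      qed
    qed
    also have "\<dots> \<le> (\<Sum>w\<in>{..<s}. prob B p (\<lambda>Y. {v, w} \<in> Y))" by (rule prob_Bex_le[OF p]) simp
    also have "\<dots> \<le> (\<Sum>w\<in>{..<s}. p)"
    proof (rule sum_mono)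
      fix w
      show "prob B p (\<lambda>Y. {v, w} \<in> Y) \<le> p"
      proof (cases "{v, w} \<in> B")
        case True
        then show ?thesis
          using prob_markov[OF p AB(4), of "{{v, w}}" "{}" 1 1 "\<lambda>Y. {v, w} \<in> Y"] by simp
      next
        case False
        then have "prob B p (\<lambda>Y. {v, w} \<in> Y) = 0" by (intro prob_eq_0) blast
        then show ?thesis using p by simp
      qed
    qed
    finally show ?thesis by simp
  qed
  have "prob (all_edges n) p (\<lambda>E. \<forall>v<n. degree n E v > m) =
    expect A p (\<lambda>X. prob B p (\<lambda>Y. \<forall>v<n. degree n (X \<union> Y) v > m))"
    unfolding AB(1) prob_def by (rule expect_Un[OF AB(3,4,2)])
  also have "\<dots> \<le> expect A p (\<lambda>X. of_bool (\<forall>v\<in>{..<s}. \<not> card (X \<inter> St v) \<le> m) + s * p)"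
  proof (rule expect_mono[OF p])
    fix X assume X: "X \<subseteq> A"
    show "prob B p (\<lambda>Y. \<forall>v<n. degree n (X \<union> Y) v > m)
      \<le> of_bool (\<forall>v\<in>{..<s}. \<not> card (X \<inter> St v) \<le> m) + s * p"
    proof (cases "\<forall>v\<in>{..<s}. \<not> card (X \<inter> St v) \<le> m")
      case True
      then show ?thesis using prob_le_1[OF p AB(4)] p by (simp add: add_increasing2)
    next
      case False
      then obtain v where "v < s" "card (X \<inter> St v) \<le> m" by auto
      then have "prob B p (\<lambda>Y. \<forall>v<n. degree n (X \<union> Y) v > m) \<le> s * p" by (rule later[OF X])
      then show ?thesis by (rule order_trans) simp
    qed
  qed
  also have "\<dots> = prob A p (\<lambda>X. \<forall>v\<in>{..<s}. \<not> card (X \<inter> St v) \<le> m) + s * p"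
    by (simp add: expect_add expect_const[OF AB(3)] prob_def)
  also have "prob A p (\<lambda>X. \<forall>v\<in>{..<s}. \<not> card (X \<inter> St v) \<le> m)
    = (\<Prod>v\<in>{..<s}. prob (St v) p (\<lambda>X. \<not> card X \<le> m))"
    unfolding A_def using fSt dSt by (intro prob_Ball_disjoint) auto
  also have "\<dots> \<le> (\<Prod>v\<in>{..<s}. 1 - ?q)"
    using single prob_nonneg[OF p] by (intro prod_mono) auto
  finally show ?thesis by simp
qed

text \<open>The choice s = n/L^2 balances two demands: s p \<le> 1.1/L must vanish, while s times
  the probability of degree \<open>m\<close> must diverge. For L = ln n the latter is of order
  n^(1/60) / L^2.\<close>

lemma prob_min_degree_large:
  fixes p L :: real
  assumes p: "0 \<le> p" "p \<le> 1/2" and L: "L \<le> n * p" "n * p \<le> 1.1 * L" "L \<ge> 200"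
    and n: "3 * L ^ 2 \<le> n"
  shows "prob (all_edges n) p (\<lambda>E. \<forall>v<n. degree n E v > nat \<lfloor>L / 20\<rfloor>)
    \<le> exp (- (exp (- (59/60) * L - 10/3) * (n / L ^ 2 - 1))) + 1.1 / L"
proof -
  define m where "m = nat \<lfloor>L / 20\<rfloor>"
  define s where "s = nat \<lfloor>n / L ^ 2\<rfloor>"
  let ?q = "real ((n - s) choose m) * p ^ m * (1 - p) ^ (n - s - m)"
  have LL: "L * 200 \<le> L ^ 2" using L by (simp add: power2_eq_square)
  have npos: "real n > 0" using n L LL by linarith
  have m: "real m \<le> L / 20" "L / 20 - 1 \<le> real m" "m \<ge> 1"
    using L unfolding m_def by linarith+
  have s: "real s \<le> n / L ^ 2" "n / L ^ 2 - 1 \<le> real s"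
  proof -
    have "0 \<le> n / L ^ 2" by simp
    then show "real s \<le> n / L ^ 2" "n / L ^ 2 - 1 \<le> real s" unfolding s_def by linarith+
  qed
  have "n / L ^ 2 \<le> n / 40000"
    using LL L by (intro divide_left_mono mult_pos_pos) auto
  then have s5: "real s \<le> n / 5" using s(1) by linarith
  then have sn: "s \<le> n" by linarith
  define N where "N = real (n - s)"
  have N: "N \<ge> 4/5 * n" using s5 sn by (simp add: N_def of_nat_diff)
  then have "N * p \<ge> 4/5 * n * p" using p by (intro mult_right_mono) auto
  \<comment> \<open>The origin of the base 16: (4/5) L = 16 (L/20).\<close>
  then have Np: "N * p \<ge> 16 * m" using L m(1) by linarith
  have mN: "m \<le> n - s"
  proof -
    have "real m \<le> N" using m(1) N n LL L by linarith
    then show ?thesis by (simp add: N_def)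
  qed
  have q: "exp (- (59/60) * L - 10/3) \<le> ?q"
  proof -
    have "(16::real) ^ m \<le> (N * p / m) ^ m"
      using Np m(3) by (intro power_mono) (auto simp: field_simps)
    also have "\<dots> = (N / m) ^ m * p ^ m" by (simp add: power_mult_distrib power_divide)
    also have "\<dots> \<le> real ((n - s) choose m) * p ^ m"
      unfolding N_def using binomial_ge_n_over_k_pow_k[OF mN, where 'a = real] p
      by (intro mult_right_mono) auto
    finally have 1: "(16::real) ^ m \<le> real ((n - s) choose m) * p ^ m" .
    have "ln (16::real) = 4 * ln 2" using ln_realpow[of 2 4] by simp
    then have "7/3 \<le> ln (16::real)" using ln_2_lower by simp
    then have "(L / 20 - 1) * (7/3) \<le> real m * ln 16" using m L by (intro mult_mono) auto
    then have "exp ((L / 20 - 1) * (7/3)) \<le> exp (real m * ln 16)" by simp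
    also have "\<dots> = 16 ^ m" by (simp add: exp_of_nat_mult)
    finally have 2: "exp ((L / 20 - 1) * (7/3)) \<le> real ((n - s) choose m) * p ^ m" using 1 by linarith
    have "- p - 2 * p ^ 2 \<le> ln (1 - p)" using p by (intro ln_one_minus_pos_lower_bound) auto
    then have "n * (- p - 2 * p ^ 2) \<le> n * ln (1 - p)" using npos by (intro mult_left_mono) auto
    \<comment> \<open>Since 2 (1.1 L)^2 = 2.42 L^2 \<le> 3 L^2 \<le> n, the quadratic term of ln (1
      - p) costs at most 1 over all n factors.\<close>
    moreover have "2 * (n * p) ^ 2 \<le> n"
    proof -
      have "(n * p) ^ 2 \<le> (1.1 * L) ^ 2" using L p by (intro power_mono) auto
      then show ?thesis using n LL L by (simp add: power_mult_distrib power2_eq_square)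
    qed
    then have "real n * (2 * (n * p ^ 2)) \<le> real n * 1" by (simp add: power2_eq_square algebra_simps)
    then have "2 * (n * p ^ 2) \<le> 1" using npos by (simp only: mult_le_cancel_left_pos)
    ultimately have "- 1.1 * L - 1 \<le> n * ln (1 - p)" using L by (simp add: algebra_simps)
    then have "exp (- 1.1 * L - 1) \<le> exp (n * ln (1 - p))" by simp
    also have "\<dots> = (1 - p) ^ n" using p by (simp add: exp_of_nat_mult)
    also have "\<dots> \<le> (1 - p) ^ (n - s - m)" using p by (intro power_decreasing) auto
    finally have 3: "exp (- 1.1 * L - 1) \<le> (1 - p) ^ (n - s - m)" .
    \<comment> \<open>The exponents add up as 7/60 - 1.1 = -59/60 and -7/3 - 1 = -10/3.\<close>
    have "exp (- (59/60) * L - 10/3) = exp ((L / 20 - 1) * (7/3)) * exp (- 1.1 * L - 1)"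
      unfolding exp_add[symmetric] by (simp add: algebra_simps)
    also have "\<dots> \<le> ?q" using 2 3 p by (intro mult_mono) auto
    finally show ?thesis .
  qed
  have q1: "?q \<le> 1"
  proof -
    have "finite {..<n - s}" by simp
    from prob_card_eq[OF this, of p m] prob_le_1[of p "{..<n - s}" "\<lambda>X. card X = m"]
    show ?thesis using p by simp
  qed
  have "prob (all_edges n) p (\<lambda>E. \<forall>v<n. degree n E v > m) \<le> (1 - ?q) ^ s + s * p"
    using p sn by (intro prob_no_low_degree) auto
  also have "(1 - ?q) ^ s \<le> exp (- ?q) ^ s"
    using q1 exp_ge_add_one_self[of "- ?q"] by (intro power_mono) auto
  also have "exp (- ?q) ^ s = exp (- (?q * s))" by (simp add: exp_of_nat2_mult[symmetric])
  also have "\<dots> \<le> exp (- (exp (- (59/60) * L - 10/3) * (n / L ^ 2 - 1)))"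
  proof -
    have "0 \<le> ?q" using q by (rule order_trans[OF exp_ge_zero])
    have "exp (- (59/60) * L - 10/3) * (n / L ^ 2 - 1) \<le> exp (- (59/60) * L - 10/3) * s"
      using s(2) by (intro mult_left_mono) auto
    also have "\<dots> \<le> ?q * s" using q by (intro mult_right_mono) auto
    finally show ?thesis by simp
  qed
  also have "s * p \<le> 1.1 / L"
  proof -
    have "s * p \<le> n / L ^ 2 * p" using s(1) p by (intro mult_right_mono) auto
    also have "\<dots> = n * p / L ^ 2" by simp
    also have "\<dots> \<le> 1.1 * L / L ^ 2" using L by (intro divide_right_mono) auto
    also have "\<dots> = 1.1 / L" using L by (simp add: power2_eq_square)
    finally show ?thesis .
  qed
  finally show ?thesis unfolding m_def by simp
qed

section \<open>Union bound over the bad events, and the limit\<close>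

lemma gnp_failure_bound:
  fixes p L \<beta> :: real
  assumes L_def: "L = ln (real n)" and \<beta>: "\<beta> = exp (-300) / 2"
    and p: "0 \<le> p" "p \<le> 1/2" and L: "L \<le> n * p" "n * p \<le> 1.1 * L" "L \<ge> 200"
    and n: "3 * L ^ 2 \<le> n"
  shows "1 - gnp_prob n p (\<lambda>E. sigma n E = min_degree n E)
    \<le> exp (- (exp (- (59/60) * L - 10/3) * (n / L ^ 2 - 1))) + 1.1 / L
      + 1.1 * n * L * exp (6 - 1.2 * L) + 1.21 * n * L ^ 2 * exp (6 - 1.2 * L)
      + (exp (n * exp (- 2 * L)) - 1) + 4 ^ n * exp (L - \<beta> ^ 2 / 2 * n * L)"
proof -
  have p1: "p \<le> 1" and L0: "0 \<le> L" using p L by auto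
  have "0 < 3 * L ^ 2" using L by simp
  then have npos: "real n > 0" using n by linarith
  have n2: "n \<ge> 2"
  proof -
    have "200 \<le> ln (real n)" using L by (simp add: L_def)
    then show ?thesis using npos by (cases "n = 1") auto
  qed
  let ?low = "\<lambda>E v. real (degree n E v) < L / 8"
  let ?B1 = "\<lambda>E. \<forall>v<n. degree n E v > nat \<lfloor>L / 20\<rfloor>"
  let ?B2 = "\<lambda>E. \<exists>(u, w)\<in>{..<n} \<times> {..<n}. {u, w} \<in> E \<and> ?low E u \<and> ?low E w"
  let ?B3 = "\<lambda>E. \<exists>(u, w, v)\<in>{..<n} \<times> {..<n} \<times> {..<n}. u \<noteq> w \<and> {u, v} \<in> E \<and> {w, v} \<in> E \<and> ?low E u \<and> ?low E w"
  let ?B4 = "\<lambda>E. \<exists>A\<in>{A. A \<subseteq> {..<n} \<and> A \<noteq> {} \<and> real (card A) \<le> \<beta> * n}.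
      real (card (E \<inter> edges_within A)) > card A * L / 100"
  let ?B5 = "\<lambda>E. \<exists>(A, B)\<in>{(A, B). A \<subseteq> {..<n} \<and> B \<subseteq> {..<n} \<and> A \<inter> B = {} \<and>
      real (card A) > \<beta> * n \<and> real (card B) > \<beta> * n}. real (card (E \<inter> edges_between A B)) < L / 10"
  let ?P = "prob (all_edges n) p"
  have good: "sigma n E = min_degree n E"
    if E: "E \<subseteq> all_edges n" and nb: "\<not> ?B1 E" "\<not> ?B2 E" "\<not> ?B3 E" "\<not> ?B4 E" "\<not> ?B5 E" for E
  proof (rule sigma_eq_min_degree_if_pseudorandom[OF refl n2 L(3) E])
    obtain v where v: "v < n" "degree n E v \<le> nat \<lfloor>L / 20\<rfloor>" using nb(1) by (auto simp: not_less)
    then have "min_degree n E \<le> nat \<lfloor>L / 20\<rfloor>" using min_degree_le order_trans by blast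
    then show "real (min_degree n E) \<le> L / 20" using L0 by linarith
  next
    fix u v assume "u \<in> {v. v < n \<and> ?low E v}" "v \<in> {v. v < n \<and> ?low E v}"
    then show "{u, v} \<notin> E" using nb(2) by auto
  next
    fix u v w assume "u \<in> {v. v < n \<and> ?low E v}" "w \<in> {v. v < n \<and> ?low E v}" "u \<noteq> w" "v < n"
    then show "\<not> ({u, v} \<in> E \<and> {w, v} \<in> E)" using nb(3) by auto
  next
    fix A assume A: "A \<subseteq> {..<n}" "real (card A) \<le> \<beta> * n"
    show "real (card (E \<inter> edges_within A)) \<le> card A * L / 100"
    proof (cases "A = {}")
      case True
      then show ?thesis by (simp add: edges_within_def)
    next
      case False
      show ?thesis
      proof (rule ccontr)
        assume "\<not> real (card (E \<inter> edges_within A)) \<le> card A * L / 100"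
        then have "real (card (E \<inter> edges_within A)) > card A * L / 100" by (rule not_le_imp_less)
        moreover have "A \<in> {A. A \<subseteq> {..<n} \<and> A \<noteq> {} \<and> real (card A) \<le> \<beta> * n}"
          using A False by (intro CollectI conjI)
        ultimately have "?B4 E" by (rule bexI)
        with nb(4) show False by (rule notE)
      qed
    qed
  next
    fix A B assume "A \<subseteq> {..<n}" "B \<subseteq> {..<n}" "A \<inter> B = {}"
      "real (card A) > \<beta> * n" "real (card B) > \<beta> * n"
    then have AB: "(A, B) \<in> {(A, B). A \<subseteq> {..<n} \<and> B \<subseteq> {..<n} \<and> A \<inter> B = {} \<and>
      real (card A) > \<beta> * n \<and> real (card B) > \<beta> * n}" by simp
    show "L / 10 \<le> real (card (E \<inter> edges_between A B))"
    proof (rule ccontr)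
      assume "\<not> L / 10 \<le> real (card (E \<inter> edges_between A B))"
      then have "case (A, B) of (A, B) \<Rightarrow> real (card (E \<inter> edges_between A B)) < L / 10"
        by (simp only: prod.case not_le)
      then have "?B5 E" using AB by (rule bexI)
      with nb(5) show False by (rule notE)
    qed
  qed
  have "1 - gnp_prob n p (\<lambda>E. sigma n E = min_degree n E) = ?P (\<lambda>E. sigma n E \<noteq> min_degree n E)"
    unfolding gnp_prob_eq by (rule prob_not[OF finite_all_edges, symmetric])
  also have "\<dots> \<le> ?P (\<lambda>E. ?B1 E \<or> (?B2 E \<or> (?B3 E \<or> (?B4 E \<or> ?B5 E))))"
  proof (rule prob_mono[OF p(1) p1], rule ccontr)
    fix E assume E: "E \<subseteq> all_edges n" and ne: "sigma n E \<noteq> min_degree n E"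
      and n: "\<not> (?B1 E \<or> (?B2 E \<or> (?B3 E \<or> (?B4 E \<or> ?B5 E))))"
    note c = n[unfolded de_Morgan_disj]
    have "sigma n E = min_degree n E"
      by (rule good[OF E c[THEN conjunct1] c[THEN conjunct2, THEN conjunct1]
          c[THEN conjunct2, THEN conjunct2, THEN conjunct1]
          c[THEN conjunct2, THEN conjunct2, THEN conjunct2, THEN conjunct1]
          c[THEN conjunct2, THEN conjunct2, THEN conjunct2, THEN conjunct2]])
    with ne show False by (rule notE)
  qed
  also have "\<dots> \<le> ?P ?B1 + (?P ?B2 + (?P ?B3 + (?P ?B4 + ?P ?B5)))"
    by (rule order_trans[OF prob_disj_le[OF p(1) p1]], rule add_left_mono)+ (rule order_refl)
  finally have main: "1 - gnp_prob n p (\<lambda>E. sigma n E = min_degree n E)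
    \<le> ?P ?B1 + (?P ?B2 + (?P ?B3 + (?P ?B4 + ?P ?B5)))" .
  have 1: "?P ?B1 \<le> exp (- (exp (- (59/60) * L - 10/3) * (n / L ^ 2 - 1))) + 1.1 / L"
    by (rule prob_min_degree_large[OF p L n])
  have "?P ?B2 \<le> real n ^ 2 * p * exp (6 - 1.2 * L)"
    by (rule prob_adjacent_low_degrees[OF p(1) p1 L(1) L0])
  also have "\<dots> = n * (n * p) * exp (6 - 1.2 * L)" by (simp add: power2_eq_square)
  \<comment> \<open>Replacing n p by 1.1 L removes p, so that the final bound is a function of n
    alone.\<close>
  also have "\<dots> \<le> n * (1.1 * L) * exp (6 - 1.2 * L)"
    using L by (intro mult_right_mono mult_left_mono) auto
  finally have 2: "?P ?B2 \<le> 1.1 * n * L * exp (6 - 1.2 * L)" by (simp only: mult_ac)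
  have "?P ?B3 \<le> real n ^ 3 * p ^ 2 * exp (6 - 1.2 * L)"
    by (rule prob_common_neighbour_low_degrees[OF p(1) p1 L(1) L0])
  also have "\<dots> = n * (n * p) ^ 2 * exp (6 - 1.2 * L)" by (simp add: power2_eq_square power3_eq_cube)
  also have "\<dots> \<le> n * (1.1 * L) ^ 2 * exp (6 - 1.2 * L)"
    using L p by (intro mult_right_mono mult_left_mono power_mono) auto
  also have "\<dots> = 1.21 * n * L ^ 2 * exp (6 - 1.2 * L)" by (simp add: power2_eq_square)
  finally have 3: "?P ?B3 \<le> 1.21 * n * L ^ 2 * exp (6 - 1.2 * L)" .
  have "?P ?B4 \<le> (1 + exp (- 2 * L)) ^ n - 1"
    by (rule prob_dense_small_set[OF p(1) p1 L(2) L0]) (simp add: \<beta>)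
  also have "(1 + exp (- 2 * L)) ^ n \<le> exp (exp (- 2 * L)) ^ n"
    by (intro power_mono exp_ge_add_one_self) (simp add: add_nonneg_nonneg)
  also have "\<dots> = exp (n * exp (- 2 * L))" by (simp only: exp_of_nat_mult)
  finally have 4: "?P ?B4 \<le> exp (n * exp (- 2 * L)) - 1" by simp
  have 5: "?P ?B5 \<le> 4 ^ n * exp (L - \<beta> ^ 2 / 2 * n * L)"
    by (rule prob_sparse_cut[OF p(1) p1 L(1) L0]) (simp add: \<beta>)
  show ?thesis using main 1 2 3 4 5 by linarith
qed

text \<open>The exponents matter here: 59/60 < 1 in the first term and 1.2 > 1 in the third and
  fourth. The constant \<open>c\<close> stays symbolic because its sign alone decides the last term,
  where n ln n beats n ln 4.\<close>

lemma failure_bound_tendsto_0: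
  fixes c :: real
  assumes "c > 0"
  shows "(\<lambda>n. exp (- (exp (- (59/60) * ln (real n) - 10/3) * (n / ln (real n) ^ 2 - 1))) + 1.1 / ln (real n)
      + 1.1 * n * ln (real n) * exp (6 - 1.2 * ln (real n))
      + 1.21 * n * ln (real n) ^ 2 * exp (6 - 1.2 * ln (real n))
      + (exp (n * exp (- 2 * ln (real n))) - 1)
      + 4 ^ n * exp (ln (real n) - c * n * ln (real n))) \<longlonglongrightarrow> 0"
proof -
  have 1: "(\<lambda>n. exp (- (exp (- (59/60) * ln (real n) - 10/3) * (n / ln (real n) ^ 2 - 1)))) \<longlonglongrightarrow> 0"
    by real_asymp
  have 2: "(\<lambda>n. 1.1 / ln (real n)) \<longlonglongrightarrow> 0" by real_asymp
  have 3: "(\<lambda>n. 1.1 * n * ln (real n) * exp (6 - 1.2 * ln (real n))) \<longlonglongrightarrow> 0" by real_asymp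
  have 4: "(\<lambda>n. 1.21 * n * ln (real n) ^ 2 * exp (6 - 1.2 * ln (real n))) \<longlonglongrightarrow> 0" by real_asymp
  have 5: "(\<lambda>n. exp (n * exp (- 2 * ln (real n))) - 1) \<longlonglongrightarrow> 0" by real_asymp
  have 6: "(\<lambda>n. 4 ^ n * exp (ln (real n) - c * n * ln (real n))) \<longlonglongrightarrow> 0"
    using assms by real_asymp
  from tendsto_add[OF tendsto_add[OF tendsto_add[OF tendsto_add[OF tendsto_add[OF 1 2] 3] 4] 5] 6]
  show ?thesis by simp
qed

theorem theorem1p2:
  fixes p :: "nat \<Rightarrow> real"
  assumes "\<And>n. 0 \<le> p n \<and> p n \<le> 1"
    and "filterlim (\<lambda>n. real n * p n - ln (real n)) at_top sequentially"
    and "eventually (\<lambda>n. p n \<le> 1.1 * ln (real n) / real n) sequentially"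
  shows "(\<lambda>n. gnp_prob n (p n) (\<lambda>E. sigma n E = min_degree n E)) \<longlonglongrightarrow> 1"
proof (rule tendsto_sandwich)
  \<comment> \<open>This is \<beta>^2 / 2 for the \<beta> of
    \<open>gnp_failure_bound\<close>.\<close>
  define c :: real where "c = (exp (-300) / 2) ^ 2 / 2"
  let ?b = "\<lambda>n. exp (- (exp (- (59/60) * ln (real n) - 10/3) * (n / ln (real n) ^ 2 - 1))) + 1.1 / ln (real n)
      + 1.1 * n * ln (real n) * exp (6 - 1.2 * ln (real n))
      + 1.21 * n * ln (real n) ^ 2 * exp (6 - 1.2 * ln (real n))
      + (exp (n * exp (- 2 * ln (real n))) - 1)
      + 4 ^ n * exp (ln (real n) - c * n * ln (real n))"
  have "(\<lambda>n. 1 - ?b n) \<longlonglongrightarrow> 1 - 0"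
    by (intro tendsto_diff tendsto_const failure_bound_tendsto_0) (simp add: c_def)
  then show "(\<lambda>n. 1 - ?b n) \<longlonglongrightarrow> 1" by simp
  have "eventually (\<lambda>n. 0 \<le> real n * p n - ln (real n)) sequentially"
    using assms(2) unfolding filterlim_at_top by blast
  moreover have "eventually (\<lambda>n. 200 \<le> ln (real n)) sequentially" by real_asymp
  moreover have "eventually (\<lambda>n. 3 * ln (real n) ^ 2 \<le> real n) sequentially" by real_asymp
  moreover have "eventually (\<lambda>n. 1.1 * ln (real n) / real n \<le> 1/2) sequentially" by real_asymp
  moreover have "eventually (\<lambda>n. real n > 0) sequentially" by real_asymp
  ultimately show "eventually (\<lambda>n. 1 - ?b n \<le> gnp_prob n (p n) (\<lambda>E. sigma n E = min_degree n E)) sequentially"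
    using assms(3)
  proof eventually_elim
    case (elim n)
    have half: "p n \<le> 1/2" using elim by linarith
    have np: "real n * p n \<le> 1.1 * ln (real n)" using elim by (simp add: field_simps)
    have "0 \<le> p n" "ln (real n) \<le> real n * p n" "200 \<le> ln (real n)" "3 * ln (real n) ^ 2 \<le> real n"
      using elim assms(1)[of n] by simp_all
    then have "1 - gnp_prob n (p n) (\<lambda>E. sigma n E = min_degree n E) \<le> ?b n"
      unfolding c_def by (intro gnp_failure_bound[OF refl refl _ half _ np])
    then show ?case by linarith
  qed
  show "eventually (\<lambda>n. gnp_prob n (p n) (\<lambda>E. sigma n E = min_degree n E) \<le> 1) sequentially"
    unfolding gnp_prob_eq using assms(1)
    by (intro always_eventually allI prob_le_1 finite_all_edges) simp_all
qed simp

end
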